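(* Consider the linear model $X_k=BX_{k-1}+CW_k$, $Y_k=HX_k+\Gamma V_k$ with a matrix $B\in\mathbb{R}^{d\times d}$, and the associated mean-field process $$\bar X_k^f=B\bar X_{k-1}^a+CW_k,\qquad \bar X_k^a=\bar m_k^a+\mathcal{T}(\bar P_k^f)(\bar X_k^f-\bar m_k^f),\qquad \bar m_k^a=\bar m_k^f+\mathcal{K}(\bar P_k^f)(Y_k-H\bar m_k^f),$$ where $\bar m_k^f,\bar P_k^f$ are the mean and covariance matrix of $\bar X_k^f$. Then the means and covariance matrices $\bar m_k^{f},\bar P_k^{f}$ of $\bar X_k^{f}$ and $\bar m_k^{a},\bar P_k^{a}$ of $\bar X_k^{a}$ satisfy, for all $k\ge 1$, $$\bar m_k^f=B\bar m_{k-1}^a,\quad \bar m_k^a=\bar m_k^f+\mathcal{K}(\bar P_k^f)(Y_k-H\bar m_k^f),\quad \bar P_k^f=B\bar P_{k-1}^aB^T+CC^T,\quad \bar P_k^a=(\mathrm{Id}-\mathcal{K}(\bar P_k^f)H)\bar P_k^f,$$ i.e. exactly the recursive equations of mean and covariance of the Kalman filter. In particular, for Gaussian initial distribution $\pi_0$ (of both $X_0$ and $\bar X_0^a$), the distribution $\bar\pi_k^a$ of the mean-field process $\bar X_k^a$ coincides with the posterior distribution $\pi_k$ of $X_k$ given $Y_{1:k}=(Y_1,\dots,Y_k)$.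
   Context: $W_k,V_k$ ($k\ge1$) are independent standard Gaussian vectors, independent of the initial condition; $Q:=CC^T$ and $R:=\Gamma\Gamma^T$ are positive definite; $H\in\mathbb{R}^{q\times d}$. In the mean-field process the observations $Y_1,Y_2,\dots$ are regarded as given (fixed), the noise $W_k$ is an independent copy of the model noise, and all laws, means and covariances refer to the remaining randomness; the initial condition $\bar X_0^a$ has finite second moments. $\mathcal{K}(P):=PH^T(R+HPH^T)^{-1}$ for symmetric positive semidefinite $P\in\mathbb{R}^{d\times d}$. $\mathcal{T}$ is a map from symmetric positive semidefinite $d\times d$ matrices to $\mathbb{R}^{d\times d}$ satisfying the square-root consistency condition $\mathcal{T}(P)P\mathcal{T}(P)^T=(\mathrm{Id}-\mathcal{K}(P)H)P$ for all $P$. *)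

theory Defs
  imports "HOL-Probability.Probability"
begin

definition pos_semidef :: "real^'n^'n \<Rightarrow> bool" where
  "pos_semidef P \<longleftrightarrow> transpose P = P \<and> (\<forall>x. 0 \<le> x \<bullet> (P *v x))"

definition pos_def :: "real^'n^'n \<Rightarrow> bool" where
  "pos_def P \<longleftrightarrow> transpose P = P \<and> (\<forall>x. x \<noteq> 0 \<longrightarrow> 0 < x \<bullet> (P *v x))"

definition kalman_gain :: "real^'d^'q \<Rightarrow> real^'q^'q \<Rightarrow> real^'d^'d \<Rightarrow> real^'q^'d" where
  "kalman_gain H R P =
     P ** transpose H ** matrix_inv (R + H ** P ** transpose H)"

definition mean_vec :: "'a measure \<Rightarrow> ('a \<Rightarrow> real^'n) \<Rightarrow> real^'n" where
  "mean_vec M X = (\<integral>\<omega>. X \<omega> \<partial>M)"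

definition cov_mat :: "'a measure \<Rightarrow> ('a \<Rightarrow> real^'n) \<Rightarrow> real^'n^'n" where
  "cov_mat M X =
     (\<chi> i j. \<integral>\<omega>. (X \<omega> $ i - mean_vec M X $ i) * (X \<omega> $ j - mean_vec M X $ j) \<partial>M)"

definition finite_second_moment :: "'a measure \<Rightarrow> ('a \<Rightarrow> real^'n) \<Rightarrow> bool" where
  "finite_second_moment M X \<longleftrightarrow>
     X \<in> borel_measurable M \<and> integrable M (\<lambda>\<omega>. (norm (X \<omega>))\<^sup>2)"

definition std_gaussian_density :: "real^'n \<Rightarrow> ennreal" where
  "std_gaussian_density x = ennreal (\<Prod>i\<in>UNIV. normal_density 0 1 (x $ i))"

(* Laws of m + A Z with Z standard Gaussian; A may be singular, so degenerate
   Gaussian laws are included. *)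
definition gaussian :: "(real^'n) measure \<Rightarrow> bool" where
  "gaussian \<mu> \<longleftrightarrow>
     (\<exists>(m :: real^'n) (A :: real^'n^'n).
        \<mu> = distr (density lborel std_gaussian_density) borel (\<lambda>z. m + A *v z))"

definition rv_events :: "'a measure \<Rightarrow> ('a \<Rightarrow> real^'n) \<Rightarrow> 'a set set" where
  "rv_events M X = {X -` A \<inter> space M | A. A \<in> sets borel}"

(* Mutual independence of xi, U 1, U 2, ...; stated through the generated
   sigma-algebras because indep_vars does not allow values of different types. *)
definition indep_init_noise ::
  "'a measure \<Rightarrow> ('a \<Rightarrow> real^'n) \<Rightarrow> (nat \<Rightarrow> 'a \<Rightarrow> real^'w) \<Rightarrow> bool" where
  "indep_init_noise M \<xi> U \<longleftrightarrow>
     prob_space.indep_sets M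
       (\<lambda>k. if k = 0 then rv_events M \<xi> else rv_events M (U k)) UNIV"

(* Mutual independence of xi, U 1, U 2, ..., V 1, V 2, ... *)
definition indep_init_noises ::
  "'a measure \<Rightarrow> ('a \<Rightarrow> real^'n) \<Rightarrow> (nat \<Rightarrow> 'a \<Rightarrow> real^'w) \<Rightarrow> (nat \<Rightarrow> 'a \<Rightarrow> real^'v) \<Rightarrow> bool"
  where
  "indep_init_noises M \<xi> U V \<longleftrightarrow>
     prob_space.indep_sets M
       (case_sum (\<lambda>k. if k = 0 then rv_events M \<xi> else rv_events M (U k))
                 (\<lambda>k. rv_events M (V k)))
       (UNIV <+> {1..})"

(* kappa is a (version of the) regular conditional distribution of X given Y:
   a probability kernel with kappa (Y) A = P(X \<in> A | sigma(Y)) almost surely. *)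
definition regular_cond_distr ::
  "'a measure \<Rightarrow> 'x measure \<Rightarrow> ('a \<Rightarrow> 'x) \<Rightarrow> 'y measure \<Rightarrow> ('a \<Rightarrow> 'y) \<Rightarrow> ('y \<Rightarrow> 'x measure) \<Rightarrow> bool"
  where
  "regular_cond_distr M S X L Y \<kappa> \<longleftrightarrow>
     X \<in> measurable M S \<and> Y \<in> measurable M L \<and>
     \<kappa> \<in> measurable L (prob_algebra S) \<and>
     (\<forall>A\<in>sets S. AE \<omega> in M.
        measure (\<kappa> (Y \<omega>)) A =
        real_cond_exp M (vimage_algebra (space M) Y L)
          (indicat_real (X -` A \<inter> space M)) \<omega>)"

end

(*
  The mean-field covariances do not depend on the observations y, so the analysis ensemble is
  Xa y k = m_k(y) + Z_k with one centred random variable Z_k serving every y; the recursions for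
  mean and covariance then follow from linearity, independence of the noise and consistency of T.

  For the posterior, put e_k = X_k - m_k(Y_1, ..., Y_k). By induction e_k is centred Gaussian with
  the Kalman covariance P_k and independent of (Y_1, ..., Y_k): with the innovation
  i_k = Y_k - H m^f_k, the pair (e_k, i_k) is a linear image of (e_(k-1), W_k, V_k), hence
  independent of (Y_1, ..., Y_(k-1)), and e_k, i_k are uncorrelated by the choice of the gain,
  hence independent. Since e_k and Z_k have the same law, X_k = m_k(Y) + e_k has conditional law
  m_k(Y) + law(Z_k). Gaussian laws enter only through characteristic functions, whose
  uniqueness in several dimensions is deduced from the one-dimensional theorem by replacing
  exp(i t_b x_b) with indicators one coordinate at a time.
*)
theory Submission
  imports Defs
begin

section \<open>Multivariate characteristic functions\<close>

text \<open>Three obstacles shape the proof. The initial covariance may be singular, so Gaussian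
  laws are handled without densities, through the formula exp(-(t \<bullet> P t) / 2). The variables
  have different dimensions, so independence is a statement about joint laws. The two processes live
  on different probability spaces, so they can be compared only through laws. The gain acts through
  the identity K S = P H^T with S = R + H P H^T. It cancels the mixed terms in the exponent of the
  joint characteristic function of e_k and i_k, and this cancellation is the independence. The
  passage to independence from the whole observation vector is then pure measure theory
  (\<open>indep_rv_exchange\<close>), since that vector is a function of its predecessor and of i_k.
  Invertibility of S asks for semidefinite P. This is not derived from the matrix recursion: the
  matrices in question are covariances of the mean-field forecasts, and the filtering part inherits
  the property from there.\<close>

lemma borel_measurable_cis [measurable (raw)]:
  assumes "f \<in> borel_measurable M"
  shows "(\<lambda>x. cis (f x)) \<in> borel_measurable M"
  by (rule borel_measurable_continuous_on[OF _ assms]) (intro continuous_intros)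

lemma borel_measurable_cnj [measurable (raw)]:
  assumes "f \<in> borel_measurable M"
  shows "(\<lambda>x. cnj (f x)) \<in> borel_measurable M"
  by (rule borel_measurable_continuous_on[OF _ assms]) (intro continuous_intros)

text \<open>\<open>Levy_uniqueness\<close> concerns probability laws, but the measures compared
  below carry a weight. The value s = 0 shows that both have the same mass \<open>c\<close>, so both
  can be normalised by it; only mass zero is argued separately.\<close>

lemma finite_measure_eqI_cis:
  fixes M N :: "real measure"
  assumes "finite_measure M" "finite_measure N"
    and sets[simp]: "sets M = sets borel" "sets N = sets borel"
    and eq: "\<And>s. (\<integral>x. cis (s * x) \<partial>M) = (\<integral>x. cis (s * x) \<partial>N)"
  shows "M = N"
proof -
  interpret M: finite_measure M by fact
  interpret N: finite_measure N by fact
  have sp[simp]: "space M = UNIV" "space N = UNIV"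
    using sets_eq_imp_space_eq[OF sets(1)] sets_eq_imp_space_eq[OF sets(2)] by auto
  define c where "c = measure M UNIV"
  have cN: "measure N UNIV = c"
    using eq[of 0] by (simp add: c_def)
  show ?thesis
  proof (cases "c = 0")
    case True
    have "emeasure M A = emeasure N A" if "A \<in> sets M" for A
    proof -
      have "measure M A \<le> 0" "measure N A \<le> 0"
        using M.bounded_measure[of A] N.bounded_measure[of A] True cN c_def by simp_all
      then have "measure M A = 0" "measure N A = 0" by (simp_all add: measure_le_0_iff)
      then show ?thesis by (simp add: M.emeasure_eq_measure N.emeasure_eq_measure)
    qed
    then show ?thesis by (intro measure_eqI) auto
  next
    case False
    then have c: "c > 0" using c_def by (simp add: zero_less_measure_iff)
    define d where "d L = density L (\<lambda>_. ennreal (1/c))" for L :: "real measure"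
    have em: "emeasure (d L) A = ennreal (1/c) * emeasure L A" if "A \<in> sets L" for L A
      using that by (simp add: d_def emeasure_density_const)
    have real_d: "real_distribution (d L)" if L: "finite_measure L" "sets L = sets borel" "measure L UNIV = c" for L
    proof -
      interpret finite_measure L by fact
      have "space L = UNIV" using sets_eq_imp_space_eq[OF L(2)] by simp
      then have "emeasure (d L) (space (d L)) = ennreal (1/c) * ennreal c"
        using L by (simp add: d_def emeasure_density_const emeasure_eq_measure)
      also have "\<dots> = 1" using c by (simp flip: ennreal_mult)
      finally have "prob_space (d L)" by (rule prob_spaceI)
      then show ?thesis using L(2) sets_eq_imp_space_eq[OF L(2)]
        by (simp add: real_distribution_def real_distribution_axioms_def d_def)
    qed
    have char_d: "char (d L) s = (1/c) *\<^sub>R (\<integral>x. cis (s * x) \<partial>L)"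
      if [measurable_cong]: "sets L = sets borel" for L s
      unfolding char_def d_def using c
      by (subst integral_density) (auto simp: cis_conv_exp)
    have "d M = d N"
      using assms c_def cN by (intro Levy_uniqueness real_d) (auto simp: char_d fun_eq_iff)
    have "emeasure M A = emeasure N A" if A: "A \<in> sets M" for A
    proof -
      have "emeasure L A = ennreal c * emeasure (d L) A" if "A \<in> sets L" for L
        using c that by (simp add: em mult.assoc[symmetric] flip: ennreal_mult)
      with A \<open>d M = d N\<close> show ?thesis by simp
    qed
    then show ?thesis by (intro measure_eqI) auto
  qed
qed

text \<open>The image under x \<mapsto> x \<bullet> b of the measure with density \<open>g\<close>
  is a finite measure on the line, and the hypothesis says that the characteristic functions of
  these images agree for \<open>M\<close> and \<open>N\<close>.\<close>

lemma integral_weight_indicator_eqI_cis: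
  fixes M N :: "'a::euclidean_space measure" and g :: "'a \<Rightarrow> real"
  assumes "prob_space M" "prob_space N"
    and sets[measurable_cong]: "sets M = sets borel" "sets N = sets borel"
    and g[measurable]: "g \<in> borel_measurable borel" and g_bd: "\<And>x. 0 \<le> g x" "\<And>x. g x \<le> K"
    and eq: "\<And>s. (\<integral>x. g x *\<^sub>R cis (s * (x \<bullet> b)) \<partial>M) = (\<integral>x. g x *\<^sub>R cis (s * (x \<bullet> b)) \<partial>N)"
    and A[measurable]: "A \<in> sets borel"
  shows "(\<integral>x. g x * indicator A (x \<bullet> b) \<partial>M) = (\<integral>x. g x * indicator A (x \<bullet> b) \<partial>N)"
proof -
  define p where "p L = distr (density L (\<lambda>x. ennreal (g x))) borel (\<lambda>x. x \<bullet> b)" for L :: "'a measure"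
  have fin: "finite_measure (p L)" if "prob_space L" and [measurable_cong]: "sets L = sets borel" for L
  proof -
    interpret prob_space L by fact
    have "emeasure (density L (\<lambda>x. ennreal (g x))) (space L) \<le> (\<integral>\<^sup>+x. ennreal K \<partial>L)"
      by (subst emeasure_density)
        (auto intro!: nn_integral_mono ennreal_leI g_bd simp del: nn_integral_const split: split_indicator)
    also have "\<dots> < \<infinity>" by (simp add: emeasure_space_1)
    finally have "finite_measure (density L (\<lambda>x. ennreal (g x)))"
      by (intro finite_measureI) auto
    then show ?thesis unfolding p_def
      by (rule finite_measure.finite_measure_distr) measurable
  qed
  have int: "(\<integral>y. f y \<partial>p L) = (\<integral>x. g x *\<^sub>R f (x \<bullet> b) \<partial>L)"
    if [measurable_cong]: "sets L = sets borel" and [measurable]: "f \<in> borel_measurable borel"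
    for L and f :: "real \<Rightarrow> 'b::{banach,second_countable_topology}"
    unfolding p_def using g_bd by (subst integral_distr) (auto simp: integral_density)
  have "p M = p N"
    using assms by (intro finite_measure_eqI_cis fin) (auto simp: int, auto simp: p_def)
  then have "(\<integral>y. indicator A y \<partial>p M) = (\<integral>y. (indicator A y::real) \<partial>p N)" by simp
  then show ?thesis using sets by (simp only: int borel_measurable_indicator A real_scaleR_def)
qed

text \<open>The one-dimensional uniqueness theorem is for nonnegative measures; a complex weight
  is reduced to it through the nonnegative weights \<open>1 + Re w\<close> and \<open>1 + Im w\<close>.\<close>

lemma integral_complex_weight_indicator_eqI_cis:
  fixes M N :: "'a::euclidean_space measure" and w :: "'a \<Rightarrow> complex"
  assumes "prob_space M" "prob_space N"
    and sets[measurable_cong]: "sets M = sets borel" "sets N = sets borel"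
    and w[measurable]: "w \<in> borel_measurable borel" and w_bd: "\<And>x. norm (w x) \<le> 1"
    and eq1: "\<And>s. (\<integral>x. cis (s * (x \<bullet> b)) \<partial>M) = (\<integral>x. cis (s * (x \<bullet> b)) \<partial>N)"
    and eqw: "\<And>s. (\<integral>x. w x * cis (s * (x \<bullet> b)) \<partial>M) = (\<integral>x. w x * cis (s * (x \<bullet> b)) \<partial>N)"
    and A[measurable]: "A \<in> sets borel"
  shows "(\<integral>x. w x * indicator A (x \<bullet> b) \<partial>M) = (\<integral>x. w x * indicator A (x \<bullet> b) \<partial>N)"
proof -
  interpret M: prob_space M by fact
  interpret N: prob_space N by fact
  have bd: "norm (Re (w x)) \<le> 1" "norm (Im (w x)) \<le> 1" for x
    using w_bd[of x] abs_Re_le_cmod[of "w x"] abs_Im_le_cmod[of "w x"] by auto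
  have intM: "integrable M f" if "f \<in> borel_measurable borel" "\<And>x. norm (f x) \<le> 1"
    for f :: "'a \<Rightarrow> 'b::{banach,second_countable_topology}"
    using that by (intro M.integrable_const_bound[of _ 1]) (auto simp: measurable_cong_sets[OF sets(1)])
  have intN: "integrable N f" if "f \<in> borel_measurable borel" "\<And>x. norm (f x) \<le> 1"
    for f :: "'a \<Rightarrow> 'b::{banach,second_countable_topology}"
    using that by (intro N.integrable_const_bound[of _ 1]) (auto simp: measurable_cong_sets[OF sets(2)])
  \<comment> \<open>Conjugating the integral turns s into -s, and the hypothesis covers all
    s.\<close>
  have eqw': "(\<integral>x. cnj (w x) * cis (s * (x \<bullet> b)) \<partial>M) = (\<integral>x. cnj (w x) * cis (s * (x \<bullet> b)) \<partial>N)" for s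
  proof -
    have "(\<integral>x. cnj (w x) * cis (s * (x \<bullet> b)) \<partial>L) = cnj (\<integral>x. w x * cis (-s * (x \<bullet> b)) \<partial>L)" for L
      by (subst Bochner_Integration.integral_cnj[symmetric]) (simp add: cis_cnj del: Bochner_Integration.integral_cnj)
    then show ?thesis using eqw[of "-s"] by simp
  qed
  \<comment> \<open>Real and imaginary part of w both have the form p w + q cnj w, so one argument
    with free coefficients serves both.\<close>
  have part: "(\<integral>x. v x * indicator A (x \<bullet> b) \<partial>M) = (\<integral>x. v x * indicator A (x \<bullet> b) \<partial>N)"
    if [measurable]: "v \<in> borel_measurable borel" and v_bd: "\<And>x. norm (v x) \<le> 1"
    and v: "\<And>x. complex_of_real (v x) = p * w x + q * cnj (w x)" for v p q
  proof -
    have eqv: "(\<integral>x. complex_of_real (v x) * cis (s * (x \<bullet> b)) \<partial>M)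
        = (\<integral>x. complex_of_real (v x) * cis (s * (x \<bullet> b)) \<partial>N)" for s
    proof -
      have "(\<integral>x. complex_of_real (v x) * cis (s * (x \<bullet> b)) \<partial>L)
        = p * (\<integral>x. w x * cis (s * (x \<bullet> b)) \<partial>L) + q * (\<integral>x. cnj (w x) * cis (s * (x \<bullet> b)) \<partial>L)"
        if "L = M \<or> L = N" for L
      proof -
        have "integrable L (\<lambda>x. w x * cis (s * (x \<bullet> b)))" "integrable L (\<lambda>x. cnj (w x) * cis (s * (x \<bullet> b)))"
          using that w_bd by (auto intro!: intM intN simp: norm_mult)
        then show ?thesis
          unfolding v distrib_right mult.assoc by (subst Bochner_Integration.integral_add) auto
      qed
      then show ?thesis using eqw eqw' by simp
    qed
    have "(\<integral>x. (1 + v x) *\<^sub>R cis (s * (x \<bullet> b)) \<partial>M) = (\<integral>x. (1 + v x) *\<^sub>R cis (s * (x \<bullet> b)) \<partial>N)" for s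
    proof -
      have "(\<integral>x. (1 + v x) *\<^sub>R cis (s * (x \<bullet> b)) \<partial>L)
        = (\<integral>x. cis (s * (x \<bullet> b)) \<partial>L) + (\<integral>x. complex_of_real (v x) * cis (s * (x \<bullet> b)) \<partial>L)"
        if "L = M \<or> L = N" for L
      proof -
        have "integrable L (\<lambda>x. cis (s * (x \<bullet> b)))" "integrable L (\<lambda>x. complex_of_real (v x) * cis (s * (x \<bullet> b)))"
          using that v_bd by (auto intro!: intM intN simp: norm_mult)
        then show ?thesis
          unfolding scaleR_add_left by (subst Bochner_Integration.integral_add) (auto simp: scaleR_conv_of_real)
      qed
      then show ?thesis using eq1 eqv by simp
    qed
    moreover have "0 \<le> 1 + v x" "1 + v x \<le> 2" for x using v_bd[of x] by auto
    ultimately have *: "(\<integral>x. (1 + v x) * indicator A (x \<bullet> b) \<partial>M) = (\<integral>x. (1 + v x) * indicator A (x \<bullet> b) \<partial>N)"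
      using assms(1,2) by (intro integral_weight_indicator_eqI_cis[where K=2] sets A) auto
    have **: "(\<integral>x. 1 * indicator A (x \<bullet> b) \<partial>M) = (\<integral>x. (1::real) * indicator A (x \<bullet> b) \<partial>N)"
      using assms(1,2) eq1 by (intro integral_weight_indicator_eqI_cis[where K=1] sets A) auto
    have "(\<integral>x. v x * indicator A (x \<bullet> b) \<partial>L)
        = (\<integral>x. (1 + v x) * indicator A (x \<bullet> b) \<partial>L) - (\<integral>x. 1 * indicator A (x \<bullet> b) \<partial>L)"
      if "L = M \<or> L = N" for L
    proof -
      have "integrable L (\<lambda>x. indicator A (x \<bullet> b) :: real)" "integrable L (\<lambda>x. v x * indicator A (x \<bullet> b))"
        using that v_bd by (auto intro!: intM intN simp: norm_mult split: split_indicator)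
      then show ?thesis unfolding distrib_right
        by (subst Bochner_Integration.integral_add) auto
    qed
    then show ?thesis using * ** by simp
  qed
  have re: "(\<integral>x. Re (w x) * indicator A (x \<bullet> b) \<partial>M) = (\<integral>x. Re (w x) * indicator A (x \<bullet> b) \<partial>N)"
    by (rule part[of _ "1/2" "1/2"]) (use bd in \<open>auto simp: complex_eq_iff\<close>)
  have im: "(\<integral>x. Im (w x) * indicator A (x \<bullet> b) \<partial>M) = (\<integral>x. Im (w x) * indicator A (x \<bullet> b) \<partial>N)"
    by (rule part[of _ "-\<i>/2" "\<i>/2"]) (use bd in \<open>auto simp: complex_eq_iff\<close>)
  have "(\<integral>x. w x * indicator A (x \<bullet> b) \<partial>L) =
      Complex (\<integral>x. Re (w x) * indicator A (x \<bullet> b) \<partial>L) (\<integral>x. Im (w x) * indicator A (x \<bullet> b) \<partial>L)"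
    if "L = M \<or> L = N" for L
  proof -
    have i: "integrable L (\<lambda>x. w x * indicator A (x \<bullet> b))"
      using that w_bd by (auto intro!: intM intN simp: norm_mult split: split_indicator)
    have "Re (w x * indicator A (x \<bullet> b)) = Re (w x) * indicator A (x \<bullet> b)"
      "Im (w x * indicator A (x \<bullet> b)) = Im (w x) * indicator A (x \<bullet> b)" for x
      by (simp_all split: split_indicator)
    then show ?thesis
      using integral_Re[OF i] integral_Im[OF i] by (simp add: complex_eq_iff)
  qed
  then show ?thesis using re im by simp
qed

lemma measure_eqI_cis:
  fixes M N :: "'a::euclidean_space measure"
  assumes "prob_space M" "prob_space N"
    and sets[measurable_cong]: "sets M = sets borel" "sets N = sets borel"
    and eq: "\<And>t. (\<integral>x. cis (t \<bullet> x) \<partial>M) = (\<integral>x. cis (t \<bullet> x) \<partial>N)"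
  shows "M = N"
proof -
  interpret M: prob_space M by fact
  interpret N: prob_space N by fact
  have sp[simp]: "space M = UNIV" "space N = UNIV"
    using sets_eq_imp_space_eq[OF sets(1)] sets_eq_imp_space_eq[OF sets(2)] by auto
  \<comment> \<open>The exponential keeps all coordinates while indicators are added one by one, and
    \<open>t\<close> stays arbitrary because the induction step uses the hypothesis at t + s b for
    every s. With \<open>J = Basis\<close> and t = 0 only the indicator of a box remains.\<close>
  have key: "(\<integral>x. (\<Prod>b\<in>J. indicator (A b) (x \<bullet> b)) * cis (t \<bullet> x) \<partial>M)
      = (\<integral>x. (\<Prod>b\<in>J. indicator (A b) (x \<bullet> b)) * cis (t \<bullet> x) \<partial>N)"
    if "finite J" "\<And>b. b \<in> J \<Longrightarrow> A b \<in> sets borel" for J A t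
    using that
  proof (induction J arbitrary: t rule: finite_induct)
    case empty
    then show ?case using eq by simp
  next
    case (insert b J)
    note [measurable] = insert.prems
    let ?w = "\<lambda>x. (\<Prod>b\<in>J. indicator (A b) (x \<bullet> b)) * cis (t \<bullet> x)"
    have "(\<integral>x. ?w x * indicator (A b) (x \<bullet> b) \<partial>M) = (\<integral>x. ?w x * indicator (A b) (x \<bullet> b) \<partial>N)"
    proof (rule integral_complex_weight_indicator_eqI_cis)
      show "?w \<in> borel_measurable borel" by measurable
      show "norm (?w x) \<le> 1" for x
        by (auto simp: norm_mult prod_norm[symmetric] intro!: prod_le_1 split: split_indicator)
      show "(\<integral>x. cis (s * (x \<bullet> b)) \<partial>M) = (\<integral>x. cis (s * (x \<bullet> b)) \<partial>N)" for s
        using eq[of "s *\<^sub>R b"] by (simp add: inner_commute)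
      show "(\<integral>x. ?w x * cis (s * (x \<bullet> b)) \<partial>M) = (\<integral>x. ?w x * cis (s * (x \<bullet> b)) \<partial>N)" for s
        using insert.IH[of "t + s *\<^sub>R b"] insert.prems
        by (simp add: mult.assoc cis_mult inner_add_left inner_commute[of b])
    qed (use assms insert.prems in auto)
    then show ?case using insert.hyps by (simp add: mult.commute mult.left_commute)
  qed
  have box: "emeasure M (box l u) = emeasure N (box l u)" for l u :: 'a
  proof -
    have ind: "(\<Prod>b\<in>Basis. indicator {l \<bullet> b<..<u \<bullet> b} (x \<bullet> b)) = (complex_of_real (indicator (box l u) x))" for x
      by (auto simp: box_def indicator_def)
    have "(\<integral>x. complex_of_real (indicator (box l u) x) \<partial>M) = (\<integral>x. complex_of_real (indicator (box l u) x) \<partial>N)"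
      using key[of Basis "\<lambda>b. {l \<bullet> b<..<u \<bullet> b}" 0] by (simp add: ind)
    then show ?thesis
      by (simp add: M.emeasure_eq_measure N.emeasure_eq_measure)
  qed
  let ?E = "range (\<lambda>(a, b). box a b :: 'a set)"
  show ?thesis
  proof (rule measure_eqI_generator_eq[where E="?E" and \<Omega>=UNIV and A="\<lambda>n. box (- real n *\<^sub>R One) (real n *\<^sub>R One)"])
    show "Int_stable ?E" by (force simp: Int_stable_def Int_interval box_Int_box)
    show "sets M = sigma_sets UNIV ?E" "sets N = sigma_sets UNIV ?E"
      using sets by (simp_all add: borel_eq_box)
    show "(\<Union>n. box (- real n *\<^sub>R One) (real n *\<^sub>R One)) = (UNIV::'a set)"
      using UN_box_eq_UNIV by auto
  qed (auto simp: box)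
qed

section \<open>The standard Gaussian measure\<close>

lemma borel_measurable_vec_nth [measurable (raw)]:
  fixes X :: "'a \<Rightarrow> real^'n"
  assumes "X \<in> borel_measurable M"
  shows "(\<lambda>\<omega>. X \<omega> $ i) \<in> borel_measurable M"
  by (rule borel_measurable_continuous_on[OF _ assms]) (intro continuous_intros)

lemma borel_measurable_matrix_vector_mult [measurable (raw)]:
  fixes A :: "real^'n^'m"
  assumes "X \<in> borel_measurable M"
  shows "(\<lambda>\<omega>. A *v X \<omega>) \<in> borel_measurable M"
  by (rule borel_measurable_continuous_on[OF _ assms]) (rule matrix_vector_mult_linear_continuous_on)

lemma borel_measurable_vec_lambda_PiM:
  fixes M :: "'n::finite \<Rightarrow> real measure"
  assumes [measurable_cong]: "\<And>i. sets (M i) = sets borel"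
  shows "vec_lambda \<in> borel_measurable (Pi\<^sub>M UNIV M)"
proof (subst borel_measurable_euclidean_space, safe)
  fix b :: "real^'n" assume "b \<in> Basis"
  then obtain i where "b = axis i 1" by (auto simp: Basis_vec_def)
  moreover have "(\<lambda>f. f i) \<in> borel_measurable (Pi\<^sub>M UNIV M)" by measurable
  ultimately show "(\<lambda>f. vec_lambda f \<bullet> b) \<in> borel_measurable (Pi\<^sub>M UNIV M)"
    by (simp add: inner_axis)
qed

text \<open>Lebesgue measure is determined by the volumes of boxes, which are products of side
  lengths. The identification gives access to Fubini over the coordinates of
  \<open>real^'n\<close>.\<close>

lemma lborel_vec_eq_distr_PiM:
  "(lborel :: (real^'n) measure) = distr (Pi\<^sub>M UNIV (\<lambda>_::'n::finite. lborel)) borel (\<lambda>f. \<chi> i. f i)"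
proof (rule lborel_eqI)
  have [measurable]: "(\<lambda>f. \<chi> i. f i) \<in> borel_measurable (Pi\<^sub>M UNIV (\<lambda>_::'n. lborel :: real measure))"
    by (rule borel_measurable_vec_lambda_PiM) simp
  interpret product_sigma_finite "\<lambda>_::'n::finite. lborel :: real measure" ..
  fix l u :: "real^'n"
  assume le: "\<And>b. b \<in> Basis \<Longrightarrow> l \<bullet> b \<le> u \<bullet> b"
  have Basis: "Basis = range (\<lambda>i. axis i (1::real) :: real^'n)"
    by (auto simp: Basis_vec_def)
  have le': "l $ i \<le> u $ i" for i
    using le[of "axis i 1"] by (simp add: inner_axis Basis)
  have "emeasure (distr (Pi\<^sub>M UNIV (\<lambda>_::'n::finite. lborel)) borel (\<lambda>f. \<chi> i. f i)) (box l u)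
      = emeasure (Pi\<^sub>M UNIV (\<lambda>_::'n::finite. lborel)) (Pi\<^sub>E UNIV (\<lambda>i. {l $ i<..<u $ i}))"
    by (subst emeasure_distr) (auto simp: mem_box_cart space_PiM PiE_iff intro!: arg_cong2[where f=emeasure])
  also have "\<dots> = (\<Prod>i\<in>UNIV. ennreal (u $ i - l $ i))"
    using le' by (subst emeasure_PiM) auto
  also have "\<dots> = (\<Prod>i\<in>UNIV. (u - l) $ i)"
    using le' by (subst prod_ennreal) auto
  also have "(\<Prod>i\<in>UNIV. (u - l) $ i) = (\<Prod>b\<in>Basis. (u - l) \<bullet> b)"
    unfolding Basis by (subst prod.reindex) (auto simp: inj_on_def axis_eq_axis inner_axis)
  finally show "emeasure (distr (Pi\<^sub>M UNIV (\<lambda>_::'n::finite. lborel)) borel (\<lambda>f. \<chi> i. f i)) (box l u)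
      = (\<Prod>b\<in>Basis. (u - l) \<bullet> b)" .
qed simp

abbreviation std_gaussian :: "(real^'n) measure" where
  "std_gaussian \<equiv> density lborel std_gaussian_density"

lemma prob_space_std_normal_distribution: "prob_space std_normal_distribution"
  using real_dist_normal_dist by (simp add: real_distribution_def)

lemma borel_measurable_std_gaussian_density [measurable]:
  "std_gaussian_density \<in> borel_measurable borel"
  unfolding std_gaussian_density_def[abs_def] by measurable

text \<open>A product of densities is a density of the product measure, as rectangles show. Thus the
  coordinates are independent standard normals, and computations reduce to one dimension.\<close>

lemma std_gaussian_eq_distr_PiM:
  "(std_gaussian :: (real^'n) measure)
    = distr (Pi\<^sub>M UNIV (\<lambda>_::'n::finite. std_normal_distribution)) borel (\<lambda>f. \<chi> i. f i)"
proof -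
  interpret L: product_sigma_finite "\<lambda>_::'n::finite. lborel :: real measure" ..
  interpret S: product_sigma_finite "\<lambda>_::'n::finite. std_normal_distribution"
    by (simp add: product_sigma_finite_def prob_space_imp_sigma_finite prob_space_std_normal_distribution)
  have [measurable]: "(\<lambda>f. \<chi> i. f i) \<in> borel_measurable (Pi\<^sub>M UNIV (\<lambda>_::'n. lborel :: real measure))"
    by (rule borel_measurable_vec_lambda_PiM) simp
  let ?P = "density (Pi\<^sub>M UNIV (\<lambda>_::'n::finite. lborel)) (\<lambda>f. \<Prod>i\<in>UNIV. ennreal (std_normal_density (f i)))"
  have P: "?P = Pi\<^sub>M UNIV (\<lambda>_::'n::finite. std_normal_distribution)"
  proof (rule S.PiM_eqI)
    show "sets ?P = sets (Pi\<^sub>M UNIV (\<lambda>_::'n::finite. std_normal_distribution))"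
      by (auto intro!: sets_PiM_cong)
    fix A :: "'n \<Rightarrow> real set" assume "\<And>i. i \<in> UNIV \<Longrightarrow> A i \<in> sets std_normal_distribution"
    then have A[measurable]: "A i \<in> sets borel" for i by auto
    have "emeasure ?P (Pi\<^sub>E UNIV A) = (\<integral>\<^sup>+f. (\<Prod>i\<in>UNIV. ennreal (std_normal_density (f i))) * indicator (Pi\<^sub>E UNIV A) f \<partial>Pi\<^sub>M UNIV (\<lambda>_::'n::finite. lborel))"
      by (rule emeasure_density) (auto intro!: sets_PiM_I_finite)
    also have "\<dots> = (\<integral>\<^sup>+f. (\<Prod>i\<in>UNIV. ennreal (std_normal_density (f i)) * indicator (A i) (f i)) \<partial>Pi\<^sub>M UNIV (\<lambda>_::'n::finite. lborel))"
    proof (rule nn_integral_cong)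
      fix f :: "'n \<Rightarrow> real"
      have "(indicator (Pi\<^sub>E UNIV A) f :: ennreal) = (\<Prod>i\<in>UNIV. indicator (A i) (f i))"
        by (auto simp: indicator_def PiE_def Pi_def)
      then show "(\<Prod>i\<in>UNIV. ennreal (std_normal_density (f i))) * indicator (Pi\<^sub>E UNIV A) f
        = (\<Prod>i\<in>UNIV. ennreal (std_normal_density (f i)) * indicator (A i) (f i))"
        by (simp add: prod.distrib)
    qed
    also have "\<dots> = (\<Prod>i\<in>UNIV. emeasure std_normal_distribution (A i))"
      by (subst L.product_nn_integral_prod) (auto simp: emeasure_density)
    finally show "emeasure ?P (Pi\<^sub>E UNIV A) = (\<Prod>i\<in>UNIV. emeasure std_normal_distribution (A i))" .
  qed simp
  have "(std_gaussian :: (real^'n) measure) = density (distr (Pi\<^sub>M UNIV (\<lambda>_::'n::finite. lborel)) borel (\<lambda>f. \<chi> i. f i)) std_gaussian_density"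
    by (simp flip: lborel_vec_eq_distr_PiM)
  also have "\<dots> = distr (density (Pi\<^sub>M UNIV (\<lambda>_::'n::finite. lborel)) (\<lambda>f. std_gaussian_density (\<chi> i. f i))) borel (\<lambda>f. \<chi> i. f i)"
    by (rule density_distr) measurable
  also have "(\<lambda>f. std_gaussian_density (\<chi> i. f i)) = (\<lambda>f::'n \<Rightarrow> real. \<Prod>i\<in>UNIV. ennreal (std_normal_density (f i)))"
    by (auto simp: std_gaussian_density_def prod_ennreal)
  finally show ?thesis by (simp add: P)
qed

text \<open>One tool for the characteristic function and for all moments: the factors are
  exponentials, or identities at selected coordinates and 1 elsewhere. The values lie in a field so
  that complex factors are allowed.\<close>

lemma std_gaussian_has_bochner_integral_prod:
  fixes h :: "'n::finite \<Rightarrow> real \<Rightarrow> 'b::{real_normed_field,banach,second_countable_topology}"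
  assumes h: "\<And>i. integrable std_normal_distribution (h i)"
  shows "has_bochner_integral std_gaussian (\<lambda>x. \<Prod>i\<in>UNIV. h i (x $ i))
    (\<Prod>i\<in>UNIV. \<integral>x. h i x \<partial>std_normal_distribution)"
proof -
  interpret S: product_sigma_finite "\<lambda>_::'n::finite. std_normal_distribution"
    by (simp add: product_sigma_finite_def prob_space_imp_sigma_finite prob_space_std_normal_distribution)
  have [measurable]: "h i \<in> borel_measurable borel" for i
    using borel_measurable_integrable[OF h[of i]] by simp
  have [measurable]: "(\<lambda>f. \<chi> i. f i) \<in> borel_measurable (Pi\<^sub>M UNIV (\<lambda>_::'n::finite. std_normal_distribution))"
    by (rule borel_measurable_vec_lambda_PiM) simp
  have "(\<lambda>x::real^'n. \<Prod>i\<in>UNIV. h i (x $ i)) \<in> borel_measurable borel" by measurable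
  then show ?thesis
    unfolding std_gaussian_eq_distr_PiM has_bochner_integral_iff
    using S.product_integrable_prod[of UNIV h] S.product_integral_prod[of UNIV h] h
    by (simp add: integrable_distr_eq integral_distr)
qed

lemma prob_space_std_gaussian: "prob_space (std_gaussian :: (real^'n) measure)"
proof -
  interpret S: product_prob_space "\<lambda>_::'n::finite. std_normal_distribution"
    by (simp add: product_prob_space_def product_prob_space_axioms_def product_sigma_finite_def
        prob_space_imp_sigma_finite prob_space_std_normal_distribution)
  show ?thesis unfolding std_gaussian_eq_distr_PiM
    by (intro prob_space.prob_space_distr prob_space_PiM prob_space_std_normal_distribution
        borel_measurable_vec_lambda_PiM) simp
qed

lemma std_gaussian_cis:
  fixes t :: "real^'n"
  shows "(\<integral>x. cis (t \<bullet> x) \<partial>std_gaussian) = complex_of_real (exp (- (t \<bullet> t) / 2))"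
proof -
  interpret S: prob_space std_normal_distribution by (rule prob_space_std_normal_distribution)
  have cis_prod: "cis (t \<bullet> x) = (\<Prod>i\<in>UNIV. cis (t $ i * x $ i))" for x
    by (simp add: cis_conv_exp inner_vec_def exp_sum[symmetric] sum_distrib_left)
  have "(\<integral>x. cis (t \<bullet> x) \<partial>std_gaussian) = (\<Prod>i\<in>UNIV. \<integral>x. cis (t $ i * x) \<partial>std_normal_distribution)"
    unfolding cis_prod
    by (rule has_bochner_integral_integral_eq[OF std_gaussian_has_bochner_integral_prod])
       (auto intro!: S.integrable_const_bound[of _ 1])
  also have "\<dots> = (\<Prod>i\<in>UNIV. complex_of_real (exp (- ((t $ i)\<^sup>2) / 2)))"
    using char_std_normal_distribution by (simp add: char_def fun_eq_iff cis_conv_exp)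
  also have "\<dots> = complex_of_real (exp (- (t \<bullet> t) / 2))"
    by (simp add: inner_vec_def power2_eq_square sum_divide_distrib exp_sum flip: of_real_prod sum_negf)
  finally show ?thesis .
qed

lemma std_gaussian_nth: "has_bochner_integral (std_gaussian :: (real^'n) measure) (\<lambda>x. x $ i) 0"
proof -
  interpret S: prob_space std_normal_distribution by (rule prob_space_std_normal_distribution)
  \<comment> \<open>A single coordinate, written as a product over all coordinates with trivial
    factors away from i.\<close>
  let ?h = "\<lambda>k x. if k = i then x else (1::real)"
  have "has_bochner_integral (std_gaussian :: (real^'n) measure) (\<lambda>x. \<Prod>k\<in>UNIV. ?h k (x $ k))
      (\<Prod>k\<in>UNIV. \<integral>x. ?h k x \<partial>std_normal_distribution)"
  proof (rule std_gaussian_has_bochner_integral_prod)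
    show "integrable std_normal_distribution (?h k)" for k
      using integrable_std_normal_distribution_moment[of 1] by (cases "k = i") auto
  qed
  moreover have "(\<Prod>k\<in>UNIV. \<integral>x. ?h k x \<partial>std_normal_distribution) = 0"
    using integral_std_normal_distribution_moment_odd[of 1]
    by (intro prod_zero bexI[of _ i]) simp_all
  ultimately show ?thesis by (simp add: prod.delta)
qed

lemma std_gaussian_nth_mult_nth:
  "has_bochner_integral (std_gaussian :: (real^'n) measure) (\<lambda>x. x $ i * x $ j) (if i = j then 1 else 0)"
proof -
  interpret S: prob_space std_normal_distribution by (rule prob_space_std_normal_distribution)
  \<comment> \<open>For i = j the factor at i is the square, with mean 1; for distinct indices the
    factor at i is a first moment, which makes the product vanish.\<close>
  let ?h = "\<lambda>k x. (if k = i then x else (1::real)) * (if k = j then x else 1)"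
  have m: "integrable std_normal_distribution (\<lambda>x. x)" "(\<integral>x. x \<partial>std_normal_distribution) = 0"
     "integrable std_normal_distribution (\<lambda>x. x * x)" "(\<integral>x. x * x \<partial>std_normal_distribution) = 1"
    using integrable_std_normal_distribution_moment[of 1] integrable_std_normal_distribution_moment[of 2]
     integral_std_normal_distribution_moment_odd[of 1] std_normal_distribution_even_moments(1)[of 1]
    by (auto simp: power2_eq_square)
  have "has_bochner_integral (std_gaussian :: (real^'n) measure) (\<lambda>x. \<Prod>k\<in>UNIV. ?h k (x $ k))
      (\<Prod>k\<in>UNIV. \<integral>x. ?h k x \<partial>std_normal_distribution)"
  proof (rule std_gaussian_has_bochner_integral_prod)
    show "integrable std_normal_distribution (?h k)" for k
      using m by (cases "k = i"; cases "k = j") auto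
  qed
  moreover have "(\<Prod>k\<in>UNIV. \<integral>x. ?h k x \<partial>std_normal_distribution) = (if i = j then 1 else 0)"
  proof (cases "i = j")
    case True
    have "(\<integral>x. ?h k x \<partial>std_normal_distribution) = 1" for k
      using m True S.prob_space by (cases "k = i") auto
    with True show ?thesis by simp
  next
    case False
    then have "(\<integral>x. ?h i x \<partial>std_normal_distribution) = 0" using m by simp
    then have "(\<Prod>k\<in>UNIV. \<integral>x. ?h k x \<partial>std_normal_distribution) = 0"
      by (intro prod_zero bexI[of _ i]) simp_all
    with False show ?thesis by simp
  qed
  moreover have "(\<Prod>k\<in>UNIV. ?h k (x $ k)) = x $ i * x $ j" for x :: "real^'n"
    unfolding prod.distrib by (simp add: prod.delta)
  ultimately show ?thesis by simp
qed

section \<open>Independence of two random variables\<close>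

text \<open>The library's \<open>indep_var\<close> only relates random variables with values in the same type.\<close>

definition indep_rv :: "'a measure \<Rightarrow> 'b measure \<Rightarrow> ('a \<Rightarrow> 'b) \<Rightarrow> 'c measure \<Rightarrow> ('a \<Rightarrow> 'c) \<Rightarrow> bool" where
  "indep_rv M S X T Z \<longleftrightarrow> X \<in> measurable M S \<and> Z \<in> measurable M T \<and>
     distr M (S \<Otimes>\<^sub>M T) (\<lambda>\<omega>. (X \<omega>, Z \<omega>)) = distr M S X \<Otimes>\<^sub>M distr M T Z"

lemma indep_rv_measurable:
  assumes "indep_rv M S X T Z"
  shows "X \<in> measurable M S" "Z \<in> measurable M T"
  using assms by (auto simp: indep_rv_def)

lemma (in prob_space) indep_rv_imp_indep_var:
  "indep_rv M S X T Z \<Longrightarrow> indep_var S X T Z"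
  by (simp add: indep_rv_def indep_var_distribution_eq)

lemma (in prob_space) indep_rv_compose:
  assumes "indep_rv M S X T Z" and [measurable]: "f \<in> measurable S S'" "g \<in> measurable T T'"
  shows "indep_rv M S' (\<lambda>\<omega>. f (X \<omega>)) T' (\<lambda>\<omega>. g (Z \<omega>))"
proof -
  have [measurable]: "X \<in> measurable M S" "Z \<in> measurable M T"
    and eq: "distr M (S \<Otimes>\<^sub>M T) (\<lambda>\<omega>. (X \<omega>, Z \<omega>)) = distr M S X \<Otimes>\<^sub>M distr M T Z"
    using assms by (auto simp: indep_rv_def)
  have "distr M (S' \<Otimes>\<^sub>M T') (\<lambda>\<omega>. (f (X \<omega>), g (Z \<omega>)))
      = distr (distr M (S \<Otimes>\<^sub>M T) (\<lambda>\<omega>. (X \<omega>, Z \<omega>))) (S' \<Otimes>\<^sub>M T') (\<lambda>(x, z). (f x, g z))"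
    by (subst distr_distr) (auto simp: comp_def)
  also have "\<dots> = distr (distr M S X) S' f \<Otimes>\<^sub>M distr (distr M T Z) T' g"
    unfolding eq
    by (intro pair_measure_distr[symmetric] prob_space_imp_sigma_finite prob_space.prob_space_distr prob_space_distr)
       measurable
  also have "\<dots> = distr M S' (\<lambda>\<omega>. f (X \<omega>)) \<Otimes>\<^sub>M distr M T' (\<lambda>\<omega>. g (Z \<omega>))"
    by (simp add: distr_distr comp_def)
  finally show ?thesis by (simp add: indep_rv_def)
qed

lemma (in prob_space) indep_rvI:
  assumes [measurable]: "X \<in> measurable M S" "Z \<in> measurable M T"
    and eq: "\<And>A B. A \<in> sets S \<Longrightarrow> B \<in> sets T \<Longrightarrow>
      emeasure M ((X -` A \<inter> space M) \<inter> (Z -` B \<inter> space M)) = emeasure M (X -` A \<inter> space M) * emeasure M (Z -` B \<inter> space M)"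
  shows "indep_rv M S X T Z"
proof -
  have "distr M S X \<Otimes>\<^sub>M distr M T Z = distr M (S \<Otimes>\<^sub>M T) (\<lambda>\<omega>. (X \<omega>, Z \<omega>))"
  proof (rule pair_measure_eqI)
    fix A B assume "A \<in> sets (distr M S X)" "B \<in> sets (distr M T Z)"
    then have [measurable]: "A \<in> sets S" "B \<in> sets T" by auto
    have "(\<lambda>\<omega>. (X \<omega>, Z \<omega>)) -` (A \<times> B) \<inter> space M = (X -` A \<inter> space M) \<inter> (Z -` B \<inter> space M)" by auto
    then show "emeasure (distr M S X) A * emeasure (distr M T Z) B
      = emeasure (distr M (S \<Otimes>\<^sub>M T) (\<lambda>\<omega>. (X \<omega>, Z \<omega>))) (A \<times> B)"
      by (simp add: emeasure_distr eq)
  qed (auto intro!: prob_space_imp_sigma_finite prob_space_distr)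
  then show ?thesis by (simp add: indep_rv_def)
qed

text \<open>The two hypotheses together say that X, Y and Z are mutually independent, so they may be
  regrouped. In the filter this lets fresh noise join the error while independence of the past
  observations is kept, and it moves the past observations to the side of the innovation.\<close>

lemma (in prob_space) indep_rv_exchange:
  assumes XY: "indep_rv M S X T Y" and XYZ: "indep_rv M (S \<Otimes>\<^sub>M T) (\<lambda>\<omega>. (X \<omega>, Y \<omega>)) U Z"
  shows "indep_rv M (S \<Otimes>\<^sub>M U) (\<lambda>\<omega>. (X \<omega>, Z \<omega>)) T Y"
proof (rule indep_rvI)
  note [measurable] = indep_rv_measurable[OF XY] indep_rv_measurable(2)[OF XYZ]
  show "(\<lambda>\<omega>. (X \<omega>, Z \<omega>)) \<in> measurable M (S \<Otimes>\<^sub>M U)" "Y \<in> measurable M T" by measurable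
  let ?X = "distr M S X" and ?Y = "distr M T Y" and ?Z = "distr M U Z"
  interpret X: prob_space ?X by (rule prob_space_distr) measurable
  interpret Y: prob_space ?Y by (rule prob_space_distr) measurable
  interpret Z: prob_space ?Z by (rule prob_space_distr) measurable
  interpret XY: pair_prob_space ?X ?Y ..
  have law_XYZ: "distr M ((S \<Otimes>\<^sub>M T) \<Otimes>\<^sub>M U) (\<lambda>\<omega>. ((X \<omega>, Y \<omega>), Z \<omega>)) = (?X \<Otimes>\<^sub>M ?Y) \<Otimes>\<^sub>M ?Z"
    using XY XYZ by (simp add: indep_rv_def)
  have "indep_rv M S (\<lambda>\<omega>. fst (X \<omega>, Y \<omega>)) U Z"
    by (rule indep_rv_compose[OF XYZ, of _ _ "\<lambda>z. z"]) measurable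
  then have law_XZ: "distr M (S \<Otimes>\<^sub>M U) (\<lambda>\<omega>. (X \<omega>, Z \<omega>)) = ?X \<Otimes>\<^sub>M ?Z"
    by (simp add: indep_rv_def)
  fix A B assume [measurable]: "A \<in> sets (S \<Otimes>\<^sub>M U)" "B \<in> sets T"
  let ?A = "(\<lambda>\<omega>. (X \<omega>, Z \<omega>)) -` A \<inter> space M" and ?B = "Y -` B \<inter> space M"
  have "emeasure M (?A \<inter> ?B) = (\<integral>\<^sup>+\<omega>. indicator A (X \<omega>, Z \<omega>) * indicator B (Y \<omega>) \<partial>M)"
  proof -
    have "(\<integral>\<^sup>+\<omega>. indicator A (X \<omega>, Z \<omega>) * indicator B (Y \<omega>) \<partial>M) = (\<integral>\<^sup>+\<omega>. indicator (?A \<inter> ?B) \<omega> \<partial>M)"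
      by (intro nn_integral_cong) (auto simp: indicator_def)
    then show ?thesis by simp
  qed
  also have "\<dots> = (\<integral>\<^sup>+((x, y), z). indicator A (x, z) * indicator B y
      \<partial>distr M ((S \<Otimes>\<^sub>M T) \<Otimes>\<^sub>M U) (\<lambda>\<omega>. ((X \<omega>, Y \<omega>), Z \<omega>)))"
    unfolding split_beta' by (subst nn_integral_distr) auto
  also have "\<dots> = (\<integral>\<^sup>+x. \<integral>\<^sup>+y. \<integral>\<^sup>+z. indicator A (x, z) * indicator B y \<partial>?Z \<partial>?Y \<partial>?X)"
    unfolding law_XYZ by (simp add: Z.nn_integral_fst[symmetric] Y.nn_integral_fst[symmetric] split_beta')
  \<comment> \<open>For fixed x the integrand is a product of a function of z and a function of y,
    so the y-integral splits off and leaves the joint law of X and Z.\<close>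
  also have "\<dots> = (\<integral>\<^sup>+x. \<integral>\<^sup>+z. indicator A (x, z) \<partial>?Z \<partial>?X) * emeasure ?Y B"
  proof -
    have "(\<integral>\<^sup>+y. \<integral>\<^sup>+z. indicator A (x, z) * indicator B y \<partial>?Z \<partial>?Y)
        = (\<integral>\<^sup>+z. indicator A (x, z) \<partial>?Z) * emeasure ?Y B" if "x \<in> space ?X" for x
      using that by (subst nn_integral_multc) (auto simp: nn_integral_cmult)
    then show ?thesis
      by (subst nn_integral_multc[symmetric]) (auto intro!: nn_integral_cong)
  qed
  also have "(\<integral>\<^sup>+x. \<integral>\<^sup>+z. indicator A (x, z) \<partial>?Z \<partial>?X) = emeasure (?X \<Otimes>\<^sub>M ?Z) A"
    by (subst Z.nn_integral_fst) auto
  also have "\<dots> = emeasure M ?A"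
    unfolding law_XZ[symmetric] by (simp add: emeasure_distr)
  also have "emeasure ?Y B = emeasure M ?B" by (simp add: emeasure_distr)
  finally show "emeasure M (?A \<inter> ?B) = emeasure M ?A * emeasure M ?B" .
qed

lemma (in prob_space) indep_rv_swap:
  assumes "indep_rv M S X T Z"
  shows "indep_rv M T Z S X"
proof -
  note [measurable] = indep_rv_measurable[OF assms]
  interpret X: prob_space "distr M S X" by (rule prob_space_distr) measurable
  interpret Z: prob_space "distr M T Z" by (rule prob_space_distr) measurable
  show ?thesis
  proof (rule indep_rvI)
    fix A B assume [measurable]: "A \<in> sets T" "B \<in> sets S"
    have "emeasure M ((X -` B \<inter> space M) \<inter> (Z -` A \<inter> space M))
        = emeasure (distr M (S \<Otimes>\<^sub>M T) (\<lambda>\<omega>. (X \<omega>, Z \<omega>))) (B \<times> A)"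
      by (subst emeasure_distr) (auto intro!: arg_cong2[where f=emeasure])
    also have "\<dots> = emeasure M (X -` B \<inter> space M) * emeasure M (Z -` A \<inter> space M)"
      using assms by (simp add: indep_rv_def Z.emeasure_pair_measure_Times emeasure_distr)
    finally show "emeasure M ((Z -` A \<inter> space M) \<inter> (X -` B \<inter> space M))
        = emeasure M (Z -` A \<inter> space M) * emeasure M (X -` B \<inter> space M)"
      by (simp add: Int_commute mult.commute)
  qed measurable
qed

section \<open>Means and covariance matrices\<close>

lemma inner_matrix_vector_mult_left:
  fixes A :: "real^'n^'m"
  shows "x \<bullet> (A *v y) = (transpose A *v x) \<bullet> y"
  by (simp add: dot_lmul_matrix)

text \<open>Covariance matrices are compared as bilinear forms: tested with t and s they become
  integrals of products of real random variables.\<close>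

lemma matrix_eq_inner:
  fixes A B :: "real^'n^'m"
  assumes "\<And>t s. t \<bullet> (A *v s) = t \<bullet> (B *v s)"
  shows "A = B"
proof -
  have "A *v s = B *v s" for s
    using assms by (meson vector_eq_ldot)
  then show ?thesis by (simp add: matrix_eq)
qed

lemma (in prob_space) finite_second_moment_integrable:
  assumes "finite_second_moment M X"
  shows "integrable M X"
proof -
  have [measurable]: "X \<in> borel_measurable M" and i: "integrable M (\<lambda>\<omega>. (norm (X \<omega>))\<^sup>2)"
    using assms by (auto simp: finite_second_moment_def)
  show ?thesis
  proof (rule Bochner_Integration.integrable_bound)
    show "integrable M (\<lambda>\<omega>. 1 + (norm (X \<omega>))\<^sup>2)" using i by simp
    have "x \<le> 1 + x\<^sup>2" for x :: real
      using zero_le_power2[of "x - 1/2"] by (simp add: power2_eq_square algebra_simps)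
    then show "AE \<omega> in M. norm (X \<omega>) \<le> norm (1 + (norm (X \<omega>))\<^sup>2)" by simp
  qed simp
qed

lemma finite_second_moment_add:
  assumes "finite_second_moment M X" "finite_second_moment M Z"
  shows "finite_second_moment M (\<lambda>\<omega>. X \<omega> + Z \<omega>)"
proof -
  have [measurable]: "X \<in> borel_measurable M" "Z \<in> borel_measurable M"
    and i: "integrable M (\<lambda>\<omega>. (norm (X \<omega>))\<^sup>2)" "integrable M (\<lambda>\<omega>. (norm (Z \<omega>))\<^sup>2)"
    using assms by (auto simp: finite_second_moment_def)
  have "integrable M (\<lambda>\<omega>. (norm (X \<omega> + Z \<omega>))\<^sup>2)"
  proof (rule Bochner_Integration.integrable_bound)
    show "integrable M (\<lambda>\<omega>. 2 * (norm (X \<omega>))\<^sup>2 + 2 * (norm (Z \<omega>))\<^sup>2)" using i by simp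
    have "(norm (x + z))\<^sup>2 \<le> 2 * (norm x)\<^sup>2 + 2 * (norm z)\<^sup>2" for x z :: "real^'b"
    proof -
      \<comment> \<open>Parallelogram law; the second square on the left is dropped
        afterwards.\<close>
      have "(norm (x + z))\<^sup>2 + (norm (x - z))\<^sup>2 = 2 * (norm x)\<^sup>2 + 2 * (norm z)\<^sup>2"
        by (simp add: power2_norm_eq_inner inner_add inner_diff inner_commute)
      then show ?thesis using zero_le_power2[of "norm (x - z)"] by linarith
    qed
    then show "AE \<omega> in M. norm ((norm (X \<omega> + Z \<omega>))\<^sup>2) \<le> norm (2 * (norm (X \<omega>))\<^sup>2 + 2 * (norm (Z \<omega>))\<^sup>2)" by simp
  qed simp
  then show ?thesis by (simp add: finite_second_moment_def)
qed

lemma finite_second_moment_mult: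
  fixes A :: "real^'n^'m"
  assumes "finite_second_moment M X"
  shows "finite_second_moment M (\<lambda>\<omega>. A *v X \<omega>)"
proof -
  have [measurable]: "X \<in> borel_measurable M" and i: "integrable M (\<lambda>\<omega>. (norm (X \<omega>))\<^sup>2)"
    using assms by (auto simp: finite_second_moment_def)
  obtain K where K: "\<And>x. norm (A *v x) \<le> norm x * K"
    using bounded_linear.bounded[OF matrix_vector_mul_bounded_linear[of A]] by blast
  have "integrable M (\<lambda>\<omega>. (norm (A *v X \<omega>))\<^sup>2)"
  proof (rule Bochner_Integration.integrable_bound)
    show "integrable M (\<lambda>\<omega>. (norm (X \<omega>))\<^sup>2 * K\<^sup>2)" using i by simp
    show "AE \<omega> in M. norm ((norm (A *v X \<omega>))\<^sup>2) \<le> norm ((norm (X \<omega>))\<^sup>2 * K\<^sup>2)"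
      using K by (auto simp: power_mult_distrib[symmetric] intro!: power_mono)
  qed simp
  then show ?thesis by (simp add: finite_second_moment_def)
qed

lemma (in prob_space) finite_second_moment_const: "finite_second_moment M (\<lambda>_. c)"
  by (simp add: finite_second_moment_def)

lemma finite_second_moment_distr:
  fixes X :: "'a \<Rightarrow> real^'n"
  assumes "X \<in> borel_measurable M"
  shows "finite_second_moment (distr M borel X) (\<lambda>x. x) \<longleftrightarrow> finite_second_moment M X"
  using assms by (simp add: finite_second_moment_def integrable_distr_eq)

lemma mean_vec_distr:
  fixes X :: "'a \<Rightarrow> real^'n"
  assumes "X \<in> borel_measurable M"
  shows "mean_vec (distr M borel X) (\<lambda>x. x) = mean_vec M X"
  using assms by (simp add: mean_vec_def integral_distr)

lemma cov_mat_distr: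
  fixes X :: "'a \<Rightarrow> real^'n"
  assumes [measurable]: "X \<in> borel_measurable M"
  shows "cov_mat (distr M borel X) (\<lambda>x. x) = cov_mat M X"
  by (simp add: cov_mat_def mean_vec_distr integral_distr)

lemma (in prob_space) integrable_inner_mult_inner:
  fixes X :: "'a \<Rightarrow> real^'n" and Z :: "'a \<Rightarrow> real^'m"
  assumes "finite_second_moment M X" "finite_second_moment M Z"
  shows "integrable M (\<lambda>\<omega>. (t \<bullet> X \<omega>) * (s \<bullet> Z \<omega>))"
proof (rule Bochner_Integration.integrable_bound)
  have [measurable]: "X \<in> borel_measurable M" "Z \<in> borel_measurable M"
    and i: "integrable M (\<lambda>\<omega>. (norm (X \<omega>))\<^sup>2)" "integrable M (\<lambda>\<omega>. (norm (Z \<omega>))\<^sup>2)"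
    using assms by (auto simp: finite_second_moment_def)
  show "integrable M (\<lambda>\<omega>. (norm t)\<^sup>2 * (norm (X \<omega>))\<^sup>2 + (norm s)\<^sup>2 * (norm (Z \<omega>))\<^sup>2)" using i by simp
  show "AE \<omega> in M. norm ((t \<bullet> X \<omega>) * (s \<bullet> Z \<omega>)) \<le> norm ((norm t)\<^sup>2 * (norm (X \<omega>))\<^sup>2 + (norm s)\<^sup>2 * (norm (Z \<omega>))\<^sup>2)"
  proof (rule AE_I2)
    fix \<omega>
    have "\<bar>t \<bullet> X \<omega>\<bar> * \<bar>s \<bullet> Z \<omega>\<bar> \<le> (norm t * norm (X \<omega>)) * (norm s * norm (Z \<omega>))"
      by (intro mult_mono Cauchy_Schwarz_ineq2) auto
    also have "\<dots> \<le> (norm t * norm (X \<omega>))\<^sup>2 + (norm s * norm (Z \<omega>))\<^sup>2"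
    proof -
      have "a * b \<le> a\<^sup>2 + b\<^sup>2" if "0 \<le> a" "0 \<le> b" for a b :: real
        using zero_le_power2[of "a - b"] mult_nonneg_nonneg[OF that] by (simp add: power2_diff)
      then show ?thesis by simp
    qed
    finally show "norm ((t \<bullet> X \<omega>) * (s \<bullet> Z \<omega>)) \<le> norm ((norm t)\<^sup>2 * (norm (X \<omega>))\<^sup>2 + (norm s)\<^sup>2 * (norm (Z \<omega>))\<^sup>2)"
      by (simp add: abs_mult power_mult_distrib)
  qed
  show "(\<lambda>\<omega>. (t \<bullet> X \<omega>) * (s \<bullet> Z \<omega>)) \<in> borel_measurable M" by measurable
qed

lemma (in prob_space) inner_cov_mat:
  fixes X :: "'a \<Rightarrow> real^'n"
  assumes X: "finite_second_moment M X"
  shows "t \<bullet> (cov_mat M X *v s) = (\<integral>\<omega>. (t \<bullet> (X \<omega> - mean_vec M X)) * (s \<bullet> (X \<omega> - mean_vec M X)) \<partial>M)"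
proof -
  let ?D = "\<lambda>\<omega>. X \<omega> - mean_vec M X"
  have D: "finite_second_moment M ?D"
    using finite_second_moment_add[OF X finite_second_moment_const[of "- mean_vec M X"]] by simp
  have int: "integrable M (\<lambda>\<omega>. ?D \<omega> $ i * ?D \<omega> $ j)" for i j
    using integrable_inner_mult_inner[OF D D, of "axis i 1" "axis j 1"] by (simp add: inner_axis')
  have "(\<integral>\<omega>. (t \<bullet> ?D \<omega>) * (s \<bullet> ?D \<omega>) \<partial>M)
    = (\<integral>\<omega>. (\<Sum>i\<in>UNIV. \<Sum>j\<in>UNIV. (t $ i * s $ j) * (?D \<omega> $ i * ?D \<omega> $ j)) \<partial>M)"
    by (intro Bochner_Integration.integral_cong refl)
       (simp add: inner_vec_def sum_product mult.assoc mult.left_commute)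
  also have "\<dots> = (\<Sum>i\<in>UNIV. \<Sum>j\<in>UNIV. (t $ i * s $ j) * (\<integral>\<omega>. ?D \<omega> $ i * ?D \<omega> $ j \<partial>M))"
    using int by (simp add: Bochner_Integration.integral_sum)
  also have "\<dots> = t \<bullet> (cov_mat M X *v s)"
    by (simp add: inner_vec_def matrix_vector_mult_def cov_mat_def sum_distrib_left ac_simps)
  finally show ?thesis ..
qed

lemma (in prob_space) pos_semidef_cov_mat:
  assumes "finite_second_moment M X"
  shows "pos_semidef (cov_mat M X)"
proof -
  have "transpose (cov_mat M X) = cov_mat M X"
    by (simp add: transpose_def cov_mat_def mult.commute)
  then show ?thesis
    by (auto simp: pos_semidef_def inner_cov_mat[OF assms] simp flip: power2_eq_square)
qed

lemma (in prob_space) mean_vec_add: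
  fixes X Z :: "'a \<Rightarrow> real^'n"
  assumes "finite_second_moment M X" "finite_second_moment M Z"
  shows "mean_vec M (\<lambda>\<omega>. X \<omega> + Z \<omega>) = mean_vec M X + mean_vec M Z"
  using assms by (simp add: mean_vec_def finite_second_moment_integrable)

lemma (in prob_space) mean_vec_mult:
  fixes A :: "real^'n^'m"
  assumes "finite_second_moment M X"
  shows "mean_vec M (\<lambda>\<omega>. A *v X \<omega>) = A *v mean_vec M X"
  unfolding mean_vec_def
  by (rule integral_bounded_linear[OF matrix_vector_mul_bounded_linear finite_second_moment_integrable[OF assms]])

lemma (in prob_space) mean_vec_const: "mean_vec M (\<lambda>_. c) = c"
  by (simp add: mean_vec_def prob_space)

lemma (in prob_space) affine_moments:
  fixes A :: "real^'n^'m"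
  assumes X: "finite_second_moment M X"
  shows finite_second_moment_affine: "finite_second_moment M (\<lambda>\<omega>. c + A *v X \<omega>)"
    and mean_vec_affine: "mean_vec M (\<lambda>\<omega>. c + A *v X \<omega>) = c + A *v mean_vec M X"
    and cov_mat_affine: "cov_mat M (\<lambda>\<omega>. c + A *v X \<omega>) = A ** cov_mat M X ** transpose A"
proof -
  show *: "finite_second_moment M (\<lambda>\<omega>. c + A *v X \<omega>)"
    by (intro finite_second_moment_add finite_second_moment_const finite_second_moment_mult X)
  show **: "mean_vec M (\<lambda>\<omega>. c + A *v X \<omega>) = c + A *v mean_vec M X"
    by (simp add: mean_vec_add mean_vec_mult mean_vec_const finite_second_moment_const finite_second_moment_mult X)
  show "cov_mat M (\<lambda>\<omega>. c + A *v X \<omega>) = A ** cov_mat M X ** transpose A"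
  proof (rule matrix_eq_inner)
    fix t s
    have "t \<bullet> ((A ** cov_mat M X ** transpose A) *v s) = (transpose A *v t) \<bullet> (cov_mat M X *v (transpose A *v s))"
      by (simp only: matrix_vector_mul_assoc[symmetric] inner_matrix_vector_mult_left)
    also have "\<dots> = (\<integral>\<omega>. (t \<bullet> (A *v (X \<omega> - mean_vec M X))) * (s \<bullet> (A *v (X \<omega> - mean_vec M X))) \<partial>M)"
      by (subst inner_cov_mat[OF X]) (simp only: inner_matrix_vector_mult_left[where A=A])
    also have "\<dots> = t \<bullet> (cov_mat M (\<lambda>\<omega>. c + A *v X \<omega>) *v s)"
      unfolding inner_cov_mat[OF *] ** by (simp add: matrix_vector_mult_diff_distrib)
    finally show "t \<bullet> (cov_mat M (\<lambda>\<omega>. c + A *v X \<omega>) *v s) = t \<bullet> ((A ** cov_mat M X ** transpose A) *v s)" ..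
  qed
qed

text \<open>Expanding the product of the centred sums leaves two mixed terms, each the expectation
  of a product of independent centred real variables, hence zero.\<close>

lemma (in prob_space) cov_mat_add_indep:
  fixes X Z :: "'a \<Rightarrow> real^'n"
  assumes X: "finite_second_moment M X" and Z: "finite_second_moment M Z"
    and indep: "indep_rv M borel X borel Z"
  shows "cov_mat M (\<lambda>\<omega>. X \<omega> + Z \<omega>) = cov_mat M X + cov_mat M Z"
proof (rule matrix_eq_inner)
  fix t s
  let ?X = "\<lambda>\<omega>. X \<omega> - mean_vec M X" and ?Z = "\<lambda>\<omega>. Z \<omega> - mean_vec M Z"
  have X': "finite_second_moment M ?X" and Z': "finite_second_moment M ?Z"
    using finite_second_moment_add[OF X finite_second_moment_const[of "- mean_vec M X"]]
      finite_second_moment_add[OF Z finite_second_moment_const[of "- mean_vec M Z"]] by simp_all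
  have zero: "(\<integral>\<omega>. t \<bullet> ?X \<omega> \<partial>M) = 0" for t
  proof -
    have "(\<integral>\<omega>. t \<bullet> ?X \<omega> \<partial>M) = t \<bullet> (\<integral>\<omega>. ?X \<omega> \<partial>M)"
      by (rule integral_inner_right) (simp add: finite_second_moment_integrable[OF X'])
    then show ?thesis using finite_second_moment_integrable[OF X] by (simp add: mean_vec_def prob_space)
  qed
  have cross: "(\<integral>\<omega>. (t \<bullet> ?X \<omega>) * (s \<bullet> ?Z \<omega>) \<partial>M) = 0" for t s
  proof -
    have "indep_rv M borel (\<lambda>\<omega>. t \<bullet> ?X \<omega>) borel (\<lambda>\<omega>. s \<bullet> ?Z \<omega>)"
      by (intro indep_rv_compose[OF indep]) measurable
    then have "(\<integral>\<omega>. (t \<bullet> ?X \<omega>) * (s \<bullet> ?Z \<omega>) \<partial>M) = (\<integral>\<omega>. t \<bullet> ?X \<omega> \<partial>M) * (\<integral>\<omega>. s \<bullet> ?Z \<omega> \<partial>M)"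
      using finite_second_moment_integrable[OF X'] finite_second_moment_integrable[OF Z']
      by (intro indep_var_lebesgue_integral indep_rv_imp_indep_var) simp_all
    then show ?thesis using zero by simp
  qed
  have split: "(t \<bullet> (X \<omega> + Z \<omega> - mean_vec M (\<lambda>\<omega>. X \<omega> + Z \<omega>))) * (s \<bullet> (X \<omega> + Z \<omega> - mean_vec M (\<lambda>\<omega>. X \<omega> + Z \<omega>)))
    = (t \<bullet> ?X \<omega>) * (s \<bullet> ?X \<omega>) + (t \<bullet> ?Z \<omega>) * (s \<bullet> ?Z \<omega>) + (t \<bullet> ?X \<omega>) * (s \<bullet> ?Z \<omega>) + (s \<bullet> ?X \<omega>) * (t \<bullet> ?Z \<omega>)" for \<omega>
    by (simp add: mean_vec_add X Z inner_diff_right inner_add_right algebra_simps)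
  have "t \<bullet> (cov_mat M (\<lambda>\<omega>. X \<omega> + Z \<omega>) *v s)
    = (\<integral>\<omega>. (t \<bullet> ?X \<omega>) * (s \<bullet> ?X \<omega>) \<partial>M) + (\<integral>\<omega>. (t \<bullet> ?Z \<omega>) * (s \<bullet> ?Z \<omega>) \<partial>M)"
    unfolding inner_cov_mat[OF finite_second_moment_add[OF X Z]] split
    by (simp add: integrable_inner_mult_inner X' Z' cross)
  also have "\<dots> = t \<bullet> ((cov_mat M X + cov_mat M Z) *v s)"
    by (simp add: inner_cov_mat X Z matrix_vector_mult_add_rdistrib inner_add_right)
  finally show "t \<bullet> (cov_mat M (\<lambda>\<omega>. X \<omega> + Z \<omega>) *v s) = t \<bullet> ((cov_mat M X + cov_mat M Z) *v s)" .
qed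

lemma std_gaussian_moments:
  shows finite_second_moment_std_gaussian: "finite_second_moment (std_gaussian :: (real^'n) measure) (\<lambda>x. x)"
    and mean_vec_std_gaussian: "mean_vec (std_gaussian :: (real^'n) measure) (\<lambda>x. x) = 0"
    and cov_mat_std_gaussian: "cov_mat (std_gaussian :: (real^'n) measure) (\<lambda>x. x) = mat 1"
proof -
  interpret prob_space "std_gaussian :: (real^'n) measure" by (rule prob_space_std_gaussian)
  have "integrable (std_gaussian :: (real^'n) measure) (\<lambda>x. \<Sum>i\<in>UNIV. x $ i * x $ i)"
    using std_gaussian_nth_mult_nth by (intro Bochner_Integration.integrable_sum) (auto simp: has_bochner_integral_iff)
  then have "integrable (std_gaussian :: (real^'n) measure) (\<lambda>x. (norm x)\<^sup>2)"
    by (simp add: power2_norm_eq_inner inner_vec_def)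
  then show f: "finite_second_moment (std_gaussian :: (real^'n) measure) (\<lambda>x. x)"
    by (simp add: finite_second_moment_def)
  have "mean_vec std_gaussian (\<lambda>x::real^'n. x) $ i = 0" for i
    using Bochner_Integration.integral_inner_left[of "axis i (1::real)" std_gaussian "\<lambda>x. x"]
      finite_second_moment_integrable[OF f] std_gaussian_nth[of i]
    by (simp add: mean_vec_def inner_axis has_bochner_integral_iff)
  then show m: "mean_vec (std_gaussian :: (real^'n) measure) (\<lambda>x. x) = 0"
    by (simp add: vec_eq_iff)
  show "cov_mat (std_gaussian :: (real^'n) measure) (\<lambda>x. x) = mat 1"
    using std_gaussian_nth_mult_nth[where 'n='n]
    by (auto simp: cov_mat_def m mat_def vec_eq_iff has_bochner_integral_iff)
qed

lemma distributed_std_gaussian_distr: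
  fixes W :: "'a \<Rightarrow> real^'n"
  assumes "distributed M lborel W std_gaussian_density"
  shows "W \<in> borel_measurable M" "distr M borel W = std_gaussian"
proof -
  show "W \<in> borel_measurable M" using distributed_measurable[OF assms] by simp
  have "distr M borel W = distr M lborel W" by (rule distr_cong) auto
  then show "distr M borel W = std_gaussian" using distributed_distr_eq_density[OF assms] by simp
qed

lemma distributed_std_gaussian_moments:
  fixes W :: "'a \<Rightarrow> real^'n"
  assumes "distributed M lborel W std_gaussian_density"
  shows "finite_second_moment M W" "mean_vec M W = 0" "cov_mat M W = mat 1"
  using distributed_std_gaussian_distr[OF assms] std_gaussian_moments[where 'n='n]
  by (metis finite_second_moment_distr mean_vec_distr cov_mat_distr)+

section \<open>Centred Gaussian vectors\<close>

text \<open>The centred normal law with covariance \<open>P\<close>, given by its characteristic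
  function so that singular \<open>P\<close> is included. Covariances are tracked as the parameter
  of this formula, and equal parameters already mean equal laws.\<close>

definition cis_gaussian :: "'a measure \<Rightarrow> ('a \<Rightarrow> real^'n) \<Rightarrow> real^'n^'n \<Rightarrow> bool" where
  "cis_gaussian M X P \<longleftrightarrow> X \<in> borel_measurable M \<and>
     (\<forall>t. (\<integral>\<omega>. cis (t \<bullet> X \<omega>) \<partial>M) = complex_of_real (exp (- (t \<bullet> (P *v t)) / 2)))"

lemma cis_gaussian_measurable: "cis_gaussian M X P \<Longrightarrow> X \<in> borel_measurable M"
  by (simp add: cis_gaussian_def)

lemma cis_gaussian_integral: 
  "cis_gaussian M X P \<Longrightarrow> (\<integral>\<omega>. cis (t \<bullet> X \<omega>) \<partial>M) = complex_of_real (exp (- (t \<bullet> (P *v t)) / 2))"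
  by (simp add: cis_gaussian_def)

lemma distributed_std_gaussian_cis_gaussian:
  fixes W :: "'a \<Rightarrow> real^'n"
  assumes "distributed M lborel W std_gaussian_density"
  shows "cis_gaussian M W (mat 1)"
proof -
  note W = distributed_std_gaussian_distr[OF assms]
  have "(\<integral>\<omega>. cis (t \<bullet> W \<omega>) \<partial>M) = (\<integral>x. cis (t \<bullet> x) \<partial>distr M borel W)" for t
    using W(1) by (simp add: integral_distr)
  then show ?thesis using W by (simp add: cis_gaussian_def std_gaussian_cis)
qed

lemma cis_gaussian_mult:
  fixes A :: "real^'n^'m"
  assumes "cis_gaussian M X P"
  shows "cis_gaussian M (\<lambda>\<omega>. A *v X \<omega>) (A ** P ** transpose A)"
proof -
  have "(\<integral>\<omega>. cis (t \<bullet> (A *v X \<omega>)) \<partial>M) = complex_of_real (exp (- (t \<bullet> ((A ** P ** transpose A) *v t)) / 2))" for t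
    using cis_gaussian_integral[OF assms, of "transpose A *v t"]
    by (simp only: matrix_vector_mul_assoc[symmetric] inner_matrix_vector_mult_left)
  then show ?thesis using cis_gaussian_measurable[OF assms] unfolding cis_gaussian_def by simp
qed

lemma (in prob_space) integral_cis_add_indep:
  fixes X :: "'a \<Rightarrow> 'b::euclidean_space" and Z :: "'a \<Rightarrow> 'c::euclidean_space"
  assumes "indep_rv M borel X borel Z"
  shows "(\<integral>\<omega>. cis (t \<bullet> X \<omega> + s \<bullet> Z \<omega>) \<partial>M) = (\<integral>\<omega>. cis (t \<bullet> X \<omega>) \<partial>M) * (\<integral>\<omega>. cis (s \<bullet> Z \<omega>) \<partial>M)"
proof -
  have rv[measurable]: "X \<in> borel_measurable M" "Z \<in> borel_measurable M"
    using indep_rv_measurable[OF assms] by auto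
  have "indep_rv M borel (\<lambda>\<omega>. cis (t \<bullet> X \<omega>)) borel (\<lambda>\<omega>. cis (s \<bullet> Z \<omega>))"
    by (intro indep_rv_compose[OF assms]) measurable
  then have "(\<integral>\<omega>. cis (t \<bullet> X \<omega>) * cis (s \<bullet> Z \<omega>) \<partial>M) = (\<integral>\<omega>. cis (t \<bullet> X \<omega>) \<partial>M) * (\<integral>\<omega>. cis (s \<bullet> Z \<omega>) \<partial>M)"
    by (intro indep_var_lebesgue_integral indep_rv_imp_indep_var)
       (auto intro!: integrable_const_bound[of _ 1])
  then show ?thesis by (simp add: cis_mult)
qed

lemma (in prob_space) cis_gaussian_add_indep:
  assumes X: "cis_gaussian M X P" and Z: "cis_gaussian M Z P'" and "indep_rv M borel X borel Z"
  shows "cis_gaussian M (\<lambda>\<omega>. X \<omega> + Z \<omega>) (P + P')"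
proof -
  have exp: "complex_of_real (exp (- a / 2)) * complex_of_real (exp (- b / 2)) = complex_of_real (exp (- (a + b) / 2))" for a b
    unfolding of_real_mult[symmetric] exp_add[symmetric] by (simp add: diff_divide_distrib)
  show ?thesis
    using integral_cis_add_indep[OF assms(3)] X Z
    by (auto simp only: cis_gaussian_def inner_add_right matrix_vector_mult_add_rdistrib exp
        intro!: borel_measurable_add)
qed

text \<open>The bridge between the two probability spaces: it identifies the law of the filter error
  on one with the law of the mean-field deviation on the other.\<close>

lemma cis_gaussian_distr_eq:
  fixes X :: "'a \<Rightarrow> real^'n" and Z :: "'b \<Rightarrow> real^'n"
  assumes "prob_space M" "prob_space N" and X: "cis_gaussian M X P" and Z: "cis_gaussian N Z P"
  shows "distr M borel X = distr N borel Z"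
proof (rule measure_eqI_cis)
  show "prob_space (distr M borel X)" "prob_space (distr N borel Z)"
    using assms by (auto intro!: prob_space.prob_space_distr dest: cis_gaussian_measurable)
  show "(\<integral>x. cis (t \<bullet> x) \<partial>distr M borel X) = (\<integral>x. cis (t \<bullet> x) \<partial>distr N borel Z)" for t
    using X Z by (simp add: integral_distr cis_gaussian_def)
qed auto

text \<open>A Gaussian law is given as the law of m + A Z, whereas the recursions start from its
  moments. The mean is m and the covariance A A^T, which is also the parameter of A Z.\<close>

lemma gaussian_imp_cis_gaussian:
  fixes \<mu> :: "(real^'n) measure"
  assumes "gaussian \<mu>"
  shows "cis_gaussian \<mu> (\<lambda>x. x - mean_vec \<mu> (\<lambda>x. x)) (cov_mat \<mu> (\<lambda>x. x))"
proof -
  obtain m and A :: "real^'n^'n" where \<mu>: "\<mu> = distr std_gaussian borel (\<lambda>z. m + A *v z)"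
    using assms by (auto simp: gaussian_def)
  interpret prob_space "std_gaussian :: (real^'n) measure" by (rule prob_space_std_gaussian)
  note moments = affine_moments[OF finite_second_moment_std_gaussian, of m A]
  have mean: "mean_vec \<mu> (\<lambda>x. x) = m" and cov: "cov_mat \<mu> (\<lambda>x. x) = A ** transpose A"
    unfolding \<mu> by (subst mean_vec_distr cov_mat_distr, measurable, simp add: moments mean_vec_std_gaussian cov_mat_std_gaussian)+
  have "cis_gaussian (std_gaussian :: (real^'n) measure) (\<lambda>x. x) (mat 1)"
    by (simp add: cis_gaussian_def std_gaussian_cis)
  from cis_gaussian_mult[OF this, of A]
  show ?thesis unfolding mean cov unfolding \<mu>
    by (simp add: cis_gaussian_def integral_distr)
qed

text \<open>The pair takes values in a Euclidean product space, so multivariate uniqueness applies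
  to its law; by Fubini the product law has the factorised characteristic function. This is how a
  vanishing cross term becomes independence.\<close>

lemma (in prob_space) indep_rv_cisI:
  fixes X :: "'a \<Rightarrow> 'b::euclidean_space" and Z :: "'a \<Rightarrow> 'c::euclidean_space"
  assumes [measurable]: "X \<in> borel_measurable M" "Z \<in> borel_measurable M"
    and eq: "\<And>t s. (\<integral>\<omega>. cis (t \<bullet> X \<omega> + s \<bullet> Z \<omega>) \<partial>M) = (\<integral>\<omega>. cis (t \<bullet> X \<omega>) \<partial>M) * (\<integral>\<omega>. cis (s \<bullet> Z \<omega>) \<partial>M)"
  shows "indep_rv M borel X borel Z"
proof -
  let ?X = "distr M borel X" and ?Z = "distr M borel Z"
  interpret X: prob_space ?X by (rule prob_space_distr) measurable
  interpret Z: prob_space ?Z by (rule prob_space_distr) measurable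
  interpret XZ: pair_prob_space ?X ?Z ..
  have "distr M (borel \<Otimes>\<^sub>M borel) (\<lambda>\<omega>. (X \<omega>, Z \<omega>)) = ?X \<Otimes>\<^sub>M ?Z"
  proof (rule measure_eqI_cis)
    show "prob_space (distr M (borel \<Otimes>\<^sub>M borel) (\<lambda>\<omega>. (X \<omega>, Z \<omega>)))" by (rule prob_space_distr) measurable
    show "prob_space (?X \<Otimes>\<^sub>M ?Z)" by (rule XZ.P.prob_space_axioms)
    show "sets (distr M (borel \<Otimes>\<^sub>M borel) (\<lambda>\<omega>. (X \<omega>, Z \<omega>))) = sets borel" by (simp add: borel_prod)
    show "sets (?X \<Otimes>\<^sub>M ?Z) = sets borel"
      unfolding borel_prod[symmetric] by (intro sets_pair_measure_cong) simp_all
    fix t :: "'b \<times> 'c"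
    obtain t1 t2 where t: "t = (t1, t2)" by (cases t)
    have [measurable]: "(\<lambda>(x, z). cis (t1 \<bullet> x + t2 \<bullet> z)) \<in> borel_measurable (?X \<Otimes>\<^sub>M ?Z)"
      by (simp add: split_beta')
    have "(\<integral>p. cis (t \<bullet> p) \<partial>distr M (borel \<Otimes>\<^sub>M borel) (\<lambda>\<omega>. (X \<omega>, Z \<omega>))) = (\<integral>\<omega>. cis (t1 \<bullet> X \<omega> + t2 \<bullet> Z \<omega>) \<partial>M)"
      by (subst integral_distr) (auto simp: t inner_prod_def)
    also have "\<dots> = (\<integral>x. cis (t1 \<bullet> x) \<partial>?X) * (\<integral>z. cis (t2 \<bullet> z) \<partial>?Z)"
      by (simp add: eq integral_distr)
    also have "\<dots> = (\<integral>x. (\<integral>z. cis (t1 \<bullet> x + t2 \<bullet> z) \<partial>?Z) \<partial>?X)"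
      by (simp flip: cis_mult)
    also have "\<dots> = (\<integral>(x, z). cis (t1 \<bullet> x + t2 \<bullet> z) \<partial>(?X \<Otimes>\<^sub>M ?Z))"
      by (rule XZ.integral_fst) (auto intro!: XZ.P.integrable_const_bound[of _ 1])
    also have "\<dots> = (\<integral>p. cis (t \<bullet> p) \<partial>(?X \<Otimes>\<^sub>M ?Z))"
      by (simp add: t inner_prod_def split_beta')
    finally show "(\<integral>p. cis (t \<bullet> p) \<partial>distr M (borel \<Otimes>\<^sub>M borel) (\<lambda>\<omega>. (X \<omega>, Z \<omega>))) = (\<integral>p. cis (t \<bullet> p) \<partial>(?X \<Otimes>\<^sub>M ?Z))" .
  qed
  then show ?thesis by (simp add: indep_rv_def)
qed

section \<open>The Kalman update\<close>

lemma transpose_add: "transpose (A + B) = transpose A + transpose (B :: 'a::semiring_1^'n^'m)"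
  by (simp add: transpose_def vec_eq_iff)

lemma pos_def_invertible:
  assumes "pos_def A"
  shows "invertible A"
proof -
  have "x = 0" if "A *v x = 0" for x
    using assms that by (force simp: pos_def_def)
  then show ?thesis by (auto simp: invertible_left_inverse matrix_left_invertible_ker)
qed

text \<open>The point where positive definiteness of \<open>R\<close> enters: the innovation
  covariance is invertible for every semidefinite \<open>P\<close>.\<close>

lemma pos_def_add_congruence:
  fixes H :: "real^'d^'q"
  assumes R: "pos_def R" and P: "pos_semidef P"
  shows "pos_def (R + H ** P ** transpose H)"
proof -
  have "x \<bullet> ((H ** P ** transpose H) *v x) = (transpose H *v x) \<bullet> (P *v (transpose H *v x))" for x
    by (simp only: matrix_vector_mul_assoc[symmetric] inner_matrix_vector_mult_left[where A=H])
  then have "0 < x \<bullet> ((R + H ** P ** transpose H) *v x)" if "x \<noteq> 0" for x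
    using R P that unfolding pos_def_def pos_semidef_def matrix_vector_mult_add_rdistrib inner_add_right
    by (metis add_pos_nonneg)
  moreover have "transpose (R + H ** P ** transpose H) = R + H ** P ** transpose H"
    using R P by (simp only: pos_def_def pos_semidef_def transpose_add matrix_transpose_mul
        transpose_transpose matrix_mul_assoc)
  ultimately show ?thesis by (simp only: pos_def_def) blast
qed

text \<open>The normal equation K S = P H^T, the property of the gain from which the update is
  analysed.\<close>

lemma kalman_gain_mult:
  fixes H :: "real^'d^'q"
  assumes R: "pos_def R" and P: "pos_semidef P"
  shows "kalman_gain H R P ** (R + H ** P ** transpose H) = P ** transpose H"
proof -
  let ?S = "R + H ** P ** transpose H"
  \<comment> \<open>\<open>matrix_inv\<close> is defined by choice, so its inverse laws require that
    an inverse exists.\<close>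
  have "matrix_inv ?S ** ?S = mat 1"
    using someI_ex[OF pos_def_invertible[OF pos_def_add_congruence[OF assms], unfolded invertible_def], of H]
    unfolding matrix_inv_def by blast
  then show ?thesis by (simp only: kalman_gain_def matrix_mul_assoc[symmetric] matrix_mul_rid)
qed

text \<open>Completing the square: the cross terms in \<open>t\<close> and \<open>s\<close> cancel, that is, the analysis error is
  uncorrelated with the innovation.\<close>

lemma kalman_quadratic_form:
  fixes H :: "real^'d^'q" and R :: "real^'q^'q" and P :: "real^'d^'d" and t :: "real^'d" and s :: "real^'q"
  assumes R: "pos_def R" and P: "pos_semidef P"
  defines "K \<equiv> kalman_gain H R P" and "S \<equiv> R + H ** P ** transpose H"
  defines "u \<equiv> s - transpose K *v t"
  shows "(t + transpose H *v u) \<bullet> (P *v (t + transpose H *v u)) + u \<bullet> (R *v u)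
    = t \<bullet> (((mat 1 - K ** H) ** P) *v t) + s \<bullet> (S *v s)"
proof -
  \<comment> \<open>With e = f - K \<eta> the form t \<bullet> e + s \<bullet> \<eta> equals t
    \<bullet> f + u \<bullet> \<eta>, which explains \<open>u\<close>; \<open>w\<close> is the share
    of \<eta> that the gain removes.\<close>
  define w where "w = transpose K *v t"
  have KS: "K ** S = P ** transpose H" unfolding K_def S_def by (rule kalman_gain_mult[OF R P])
  have P_sym: "x \<bullet> (P *v y) = y \<bullet> (P *v x)" for x y
    using P by (metis inner_commute inner_matrix_vector_mult_left pos_semidef_def)
  have S_sym: "x \<bullet> (S *v y) = y \<bullet> (S *v x)" for x y
    using pos_def_add_congruence[OF R P, of H] unfolding S_def[symmetric]
    by (metis inner_commute inner_matrix_vector_mult_left pos_def_def)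
  have tK: "t \<bullet> (K *v z) = w \<bullet> z" for z unfolding w_def by (rule inner_matrix_vector_mult_left)
  \<comment> \<open>The normal equation read from right to left: P H^T is replaced by K S, and K
    passes to the other side of the inner product.\<close>
  have 1: "t \<bullet> (P *v (transpose H *v z)) = w \<bullet> (S *v z)" for z
    using tK[of "S *v z"] by (simp only: matrix_vector_mul_assoc KS)
  have 2: "(transpose H *v u) \<bullet> (P *v (transpose H *v u)) + u \<bullet> (R *v u) = u \<bullet> (S *v u)"
    unfolding S_def matrix_vector_mult_add_rdistrib inner_add_right
    by (simp only: matrix_vector_mul_assoc[symmetric] inner_matrix_vector_mult_left[where A=H])
  \<comment> \<open>This is the reduction of variance: the amount K H P by which the update lowers
    P.\<close>
  have 3: "w \<bullet> (S *v w) = t \<bullet> ((K ** H ** P) *v t)"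
    unfolding 1[symmetric] P_sym[of t] matrix_vector_mul_assoc[symmetric] tK
    by (simp only: inner_matrix_vector_mult_left[where A=H])
  have u: "u = s - w" by (simp add: u_def w_def)
  have "(t + transpose H *v u) \<bullet> (P *v (t + transpose H *v u)) + u \<bullet> (R *v u)
     = t \<bullet> (P *v t) + 2 * (t \<bullet> (P *v (transpose H *v u))) + ((transpose H *v u) \<bullet> (P *v (transpose H *v u)) + u \<bullet> (R *v u))"
    using P_sym[of t "transpose H *v u"]
    by (simp add: matrix_vector_right_distrib inner_add_left inner_add_right del: transpose_matrix_vector)
  also have "\<dots> = t \<bullet> (P *v t) + 2 * (w \<bullet> (S *v u)) + u \<bullet> (S *v u)"
    unfolding 2 1 ..
  \<comment> \<open>Inserting u = s - w, the terms w \<bullet> S s occur with coefficients 2 and -2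
    and cancel.\<close>
  also have "\<dots> = t \<bullet> (P *v t) - w \<bullet> (S *v w) + s \<bullet> (S *v s)"
    using S_sym[of s w]
    by (simp add: u matrix_vector_mult_diff_distrib inner_diff_left inner_diff_right algebra_simps)
  also have "t \<bullet> (P *v t) - w \<bullet> (S *v w) = t \<bullet> (((mat 1 - K ** H) ** P) *v t)"
    unfolding 3 matrix_vector_mul_assoc[symmetric] matrix_vector_mult_diff_rdistrib
    by (simp add: inner_diff_right)
  finally show ?thesis .
qed

text \<open>Every linear form in \<open>e\<close> and \<open>\<eta>\<close> is a linear form in the
  independent Gaussians \<open>f\<close> and \<open>V\<close>, so the joint characteristic function
  is explicit. By \<open>kalman_quadratic_form\<close> its exponent is a part in t plus a part in s.
  The factorisation gives independence, and s = 0 gives the law of \<open>e\<close>.\<close>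

lemma (in prob_space) kalman_update_errors:
  fixes f :: "'a \<Rightarrow> real^'d" and V :: "'a \<Rightarrow> real^'v" and H :: "real^'d^'q" and \<Gamma> :: "real^'v^'q"
  assumes f: "cis_gaussian M f P" and V: "cis_gaussian M V (mat 1)" and indep: "indep_rv M borel f borel V"
    and R: "pos_def (\<Gamma> ** transpose \<Gamma>)" and P: "pos_semidef P"
  defines "K \<equiv> kalman_gain H (\<Gamma> ** transpose \<Gamma>) P"
  defines "\<eta> \<equiv> \<lambda>\<omega>. H *v f \<omega> + \<Gamma> *v V \<omega>"
  defines "e \<equiv> \<lambda>\<omega>. f \<omega> - K *v \<eta> \<omega>"
  shows "cis_gaussian M e ((mat 1 - K ** H) ** P)" and "indep_rv M borel e borel \<eta>"
proof -
  note [measurable] = cis_gaussian_measurable[OF f] cis_gaussian_measurable[OF V]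
  have [measurable]: "\<eta> \<in> borel_measurable M" unfolding \<eta>_def by measurable
  have [measurable]: "e \<in> borel_measurable M" unfolding e_def by measurable
  let ?S = "\<Gamma> ** transpose \<Gamma> + H ** P ** transpose H"
  let ?E = "(mat 1 - K ** H) ** P"
  have cf: "(\<integral>\<omega>. cis (t \<bullet> e \<omega> + s \<bullet> \<eta> \<omega>) \<partial>M)
      = complex_of_real (exp (- (t \<bullet> (?E *v t)) / 2)) * complex_of_real (exp (- (s \<bullet> (?S *v s)) / 2))" for t s
  proof -
    \<comment> \<open>\<open>a\<close> and \<open>b\<close> are the coefficients of \<open>f\<close>
      and \<open>V\<close> in t \<bullet> e + s \<bullet> \<eta>, found by moving K, H and \<Gamma>
      across the inner product.\<close>
    define u where "u = s - transpose K *v t"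
    define a where "a = t + transpose H *v u"
    define b where "b = transpose \<Gamma> *v u"
    have "t \<bullet> e \<omega> + s \<bullet> \<eta> \<omega> = a \<bullet> f \<omega> + b \<bullet> V \<omega>" for \<omega>
    proof -
      have "t \<bullet> e \<omega> + s \<bullet> \<eta> \<omega> = t \<bullet> f \<omega> + u \<bullet> \<eta> \<omega>"
        by (simp only: e_def u_def inner_diff_left inner_diff_right inner_matrix_vector_mult_left[where A=K])
      also have "\<dots> = a \<bullet> f \<omega> + b \<bullet> V \<omega>"
        by (simp only: \<eta>_def a_def b_def inner_add_left inner_add_right add.assoc
            inner_matrix_vector_mult_left[where A=H] inner_matrix_vector_mult_left[where A=\<Gamma>])
      finally show ?thesis .
    qed
    then have "(\<integral>\<omega>. cis (t \<bullet> e \<omega> + s \<bullet> \<eta> \<omega>) \<partial>M) = (\<integral>\<omega>. cis (a \<bullet> f \<omega>) \<partial>M) * (\<integral>\<omega>. cis (b \<bullet> V \<omega>) \<partial>M)"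
      using integral_cis_add_indep[OF indep, of a b] by simp
    also have "\<dots> = complex_of_real (exp (- (a \<bullet> (P *v a) + b \<bullet> b) / 2))"
      unfolding cis_gaussian_integral[OF f] cis_gaussian_integral[OF V] of_real_mult[symmetric] exp_add[symmetric]
      by (simp add: diff_divide_distrib)
    also have "b \<bullet> b = u \<bullet> ((\<Gamma> ** transpose \<Gamma>) *v u)"
      by (simp only: b_def matrix_vector_mul_assoc[symmetric] inner_matrix_vector_mult_left[where A=\<Gamma>])
    also have "a \<bullet> (P *v a) + u \<bullet> ((\<Gamma> ** transpose \<Gamma>) *v u) = t \<bullet> (?E *v t) + s \<bullet> (?S *v s)"
      unfolding a_def u_def K_def by (rule kalman_quadratic_form[OF R P])
    finally show ?thesis
      unfolding of_real_mult[symmetric] exp_add[symmetric] by (simp add: diff_divide_distrib)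
  qed
  have cf_e: "(\<integral>\<omega>. cis (t \<bullet> e \<omega>) \<partial>M) = complex_of_real (exp (- (t \<bullet> (?E *v t)) / 2))" for t
    using cf[of t 0] by simp
  have cf_\<eta>: "(\<integral>\<omega>. cis (s \<bullet> \<eta> \<omega>) \<partial>M) = complex_of_real (exp (- (s \<bullet> (?S *v s)) / 2))" for s
    using cf[of 0 s] by simp
  show "cis_gaussian M e ?E" by (simp add: cis_gaussian_def cf_e)
  show "indep_rv M borel e borel \<eta>" by (rule indep_rv_cisI) (simp_all add: cf cf_e cf_\<eta>)
qed

section \<open>Conditional distributions of independent shifts\<close>

text \<open>Disjoint blocks of independent intersection-stable generators span independent
  sigma-algebras. Measurability over the spanned sigma-algebra expresses that a variable is a
  function of its block, whatever the types of the members are.\<close>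

lemma (in prob_space) indep_sets_imp_indep_rv:
  assumes indep: "indep_sets F I" and stable: "\<And>i. i \<in> I \<Longrightarrow> Int_stable (F i)"
    and J: "J1 \<subseteq> I" "J2 \<subseteq> I" "J1 \<inter> J2 = {}"
    and X: "X \<in> measurable (sigma (space M) (\<Union>i\<in>J1. F i)) S"
    and Z: "Z \<in> measurable (sigma (space M) (\<Union>i\<in>J2. F i)) T"
  shows "indep_rv M S X T Z"
proof -
  \<comment> \<open>Two blocks as a family over the booleans, so that the grouping theorem for
    partitions of the index set applies.\<close>
  define J where "J b = (if b then J1 else J2)" for b
  have events: "F i \<subseteq> events" if "i \<in> I" for i
    using indep that by (auto simp: indep_sets_def)
  have J_sub: "J b \<subseteq> I" for b using J by (simp add: J_def)
  have gen: "(\<Union>i\<in>J b. F i) \<subseteq> events" for b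
    using events J_sub by (intro UN_least) blast
  have sub: "(\<Union>i\<in>J b. F i) \<subseteq> Pow (space M)" for b
    using gen[of b] sets.space_closed[of M] by (rule subset_trans)
  have indep': "indep_sets (\<lambda>b. sigma_sets (space M) (\<Union>i\<in>J b. F i)) UNIV"
  proof (rule indep_sets_collect_sigma)
    show "indep_sets F (\<Union>b\<in>UNIV. J b)"
      by (rule indep_sets_mono_index[OF _ indep]) (use J_sub in \<open>blast\<close>)
    show "Int_stable (F i)" if "i \<in> J b" for b i
      using that J_sub stable by blast
    show "disjoint_family_on J UNIV"
      using J(3) by (auto simp: disjoint_family_on_def J_def)
  qed
  have prod: "prob (A \<inter> B) = prob A * prob B"
    if "A \<in> sigma_sets (space M) (\<Union>i\<in>J1. F i)" "B \<in> sigma_sets (space M) (\<Union>i\<in>J2. F i)" for A B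
  proof -
    have *: "\<forall>b\<in>UNIV. (if b then A else B) \<in> sigma_sets (space M) (\<Union>i\<in>J b. F i)"
      using that by (simp add: J_def)
    have "prob (\<Inter>b\<in>UNIV. if b then A else B) = (\<Prod>b\<in>UNIV. prob (if b then A else B))"
      by (rule indep_setsD[OF indep' subset_UNIV _ _ *]) simp_all
    then show ?thesis by (simp add: UNIV_bool Int_commute mult.commute)
  qed
  have preX: "X -` A \<inter> space M \<in> sigma_sets (space M) (\<Union>i\<in>J1. F i)" if "A \<in> sets S" for A
    using measurable_sets[OF X that] sub[of True] by (simp add: J_def)
  have preZ: "Z -` A \<inter> space M \<in> sigma_sets (space M) (\<Union>i\<in>J2. F i)" if "A \<in> sets T" for A
    using measurable_sets[OF Z that] sub[of False] by (simp add: J_def)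
  have subalg: "sigma_sets (space M) (\<Union>i\<in>J b. F i) \<subseteq> events" for b
    using gen by (rule sets.sigma_sets_subset)
  show ?thesis
  proof (rule indep_rvI)
    show "X \<in> measurable M S"
    proof (rule measurableI)
      show "X \<omega> \<in> space S" if "\<omega> \<in> space M" for \<omega>
        using measurable_space[OF X, of \<omega>] that by (simp add: space_measure_of_conv)
      show "X -` A \<inter> space M \<in> events" if "A \<in> sets S" for A
        using preX[OF that] subalg[of True] by (auto simp: J_def)
    qed
    show "Z \<in> measurable M T"
    proof (rule measurableI)
      show "Z \<omega> \<in> space T" if "\<omega> \<in> space M" for \<omega>
        using measurable_space[OF Z, of \<omega>] that by (simp add: space_measure_of_conv)
      show "Z -` A \<inter> space M \<in> events" if "A \<in> sets T" for A
        using preZ[OF that] subalg[of False] by (auto simp: J_def)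
    qed
    show "emeasure M ((X -` A \<inter> space M) \<inter> (Z -` B \<inter> space M)) = emeasure M (X -` A \<inter> space M) * emeasure M (Z -` B \<inter> space M)"
      if "A \<in> sets S" "B \<in> sets T" for A B
      using prod[OF preX[OF that(1)] preZ[OF that(2)]]
      by (simp add: emeasure_eq_measure ennreal_mult)
  qed
qed

lemma Int_stable_rv_events: "Int_stable (rv_events M X)"
proof (rule Int_stableI)
  fix a b assume "a \<in> rv_events M X" "b \<in> rv_events M X"
  then obtain A B where "a = X -` A \<inter> space M" "b = X -` B \<inter> space M" "A \<in> sets borel" "B \<in> sets borel"
    by (auto simp: rv_events_def)
  then show "a \<inter> b \<in> rv_events M X"
    by (auto simp: rv_events_def intro!: exI[of _ "A \<inter> B"])
qed

lemma measurable_sigma_rv_events: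
  fixes X :: "'a \<Rightarrow> real^'n"
  assumes "i \<in> J" "F i = rv_events M X" and sub: "(\<Union>i\<in>J. F i) \<subseteq> Pow (space M)"
  shows "X \<in> borel_measurable (sigma (space M) (\<Union>i\<in>J. F i))"
proof (rule measurableI)
  fix A :: "(real^'n) set" assume "A \<in> sets borel"
  then have "X -` A \<inter> space M \<in> (\<Union>i\<in>J. F i)"
    using assms by (auto simp: rv_events_def)
  then show "X -` A \<inter> space (sigma (space M) (\<Union>i\<in>J. F i)) \<in> sets (sigma (space M) (\<Union>i\<in>J. F i))"
    using sub by (simp add: space_measure_of)
qed simp

text \<open>Freezing: as \<open>E\<close> is independent of \<open>Y\<close>, conditioning on Y = y
  replaces m(Y) by the constant m(y) and leaves the law of \<open>E\<close> alone. The kernel is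
  built from a copy \<open>Z\<close> of \<open>E\<close> on another space. The defining property of
  conditional expectation is checked on events that \<open>Y\<close> lies in a given set, by Fubini
  for the product law.\<close>

lemma regular_cond_distr_shift:
  fixes X E :: "'a \<Rightarrow> real^'n" and Z :: "'b \<Rightarrow> real^'n"
  assumes "prob_space M" "prob_space N" and indep: "indep_rv M borel E L Y"
    and [measurable]: "m \<in> borel_measurable L"
    and X: "\<And>\<omega>. \<omega> \<in> space M \<Longrightarrow> X \<omega> = m (Y \<omega>) + E \<omega>"
    and [measurable]: "Z \<in> borel_measurable N" and law: "distr N borel Z = distr M borel E"
    and \<kappa>: "\<And>y. y \<in> space L \<Longrightarrow> \<kappa> y = distr N borel (\<lambda>\<omega>. m y + Z \<omega>)"
  shows "regular_cond_distr M borel X L Y \<kappa>"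
proof -
  interpret M: prob_space M by fact
  note [measurable] = indep_rv_measurable[OF indep]
  let ?\<mu> = "distr M borel E" and ?\<nu> = "distr M L Y"
  interpret \<mu>: prob_space ?\<mu> by (rule M.prob_space_distr) measurable
  interpret \<nu>: prob_space ?\<nu> by (rule M.prob_space_distr) measurable
  interpret P: pair_prob_space ?\<mu> ?\<nu> ..
  have X_meas: "X \<in> borel_measurable M"
    by (subst measurable_cong[OF X]) measurable
  \<comment> \<open>The kernel as the image of one fixed law under a map depending measurably on y,
    from which its measurability in y follows.\<close>
  have \<kappa>': "\<kappa> y = distr ?\<mu> borel (\<lambda>z. m y + z)" if "y \<in> space L" for y
    unfolding \<kappa>[OF that] law[symmetric] by (subst distr_distr) (auto simp: comp_def)
  have \<kappa>_meas: "\<kappa> \<in> measurable L (prob_algebra borel)"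
  proof (subst measurable_cong[OF \<kappa>'])
    have "?\<mu> \<in> space (prob_algebra borel)"
      by (simp add: space_prob_algebra \<mu>.prob_space_axioms)
    then show "(\<lambda>y. distr ?\<mu> borel (\<lambda>z. m y + z)) \<in> measurable L (prob_algebra borel)"
      by (intro measurable_distr_prob_space2[where M=borel] measurable_const) auto
  qed
  let ?F = "vimage_algebra (space M) Y L"
  have Y_space: "Y \<in> space M \<rightarrow> space L" using measurable_space[of Y M L] by auto
  have F_sets: "sets ?F = {Y -` B \<inter> space M | B. B \<in> sets L}"
    using Y_space by (rule sets_vimage_algebra2)
  have "subalgebra M ?F"
    by (auto simp: subalgebra_def F_sets)
  then interpret F: finite_measure_subalgebra M ?F
    by unfold_locales
  have Y_F: "Y \<in> measurable ?F L" using Y_space by (rule measurable_vimage_algebra1)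
  have "AE \<omega> in M. measure (\<kappa> (Y \<omega>)) A = real_cond_exp M ?F (indicat_real (X -` A \<inter> space M)) \<omega>"
    if [measurable]: "A \<in> sets borel" for A
  proof -
    note [measurable] = X_meas
    have \<kappa>A[measurable]: "(\<lambda>y. measure (\<kappa> y) A) \<in> borel_measurable L"
      using \<kappa>_meas by measurable
    have \<kappa>A_le: "measure (\<kappa> y) A \<le> 1" if "y \<in> space L" for y
      using measurable_space[OF \<kappa>_meas that] by (simp add: space_prob_algebra prob_space.prob_le_1)
    have "AE \<omega> in M. real_cond_exp M ?F (indicat_real (X -` A \<inter> space M)) \<omega> = measure (\<kappa> (Y \<omega>)) A"
    proof (rule F.real_cond_exp_charact)
      show "integrable M (indicat_real (X -` A \<inter> space M))"
        by (simp add: M.emeasure_eq_measure)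
      show "integrable M (\<lambda>\<omega>. measure (\<kappa> (Y \<omega>)) A)"
        by (rule M.integrable_const_bound[of _ 1]) (auto intro!: \<kappa>A_le AE_I2 measurable_space[of Y M L])
      show "(\<lambda>\<omega>. measure (\<kappa> (Y \<omega>)) A) \<in> borel_measurable ?F"
        using measurable_compose[OF Y_F \<kappa>A] .
      fix G assume "G \<in> sets ?F"
      then obtain B where [measurable]: "B \<in> sets L" and G: "G = Y -` B \<inter> space M"
        by (auto simp: F_sets)
      have "(\<integral>\<omega>\<in>G. indicat_real (X -` A \<inter> space M) \<omega> \<partial>M) = (\<integral>\<omega>. indicator B (Y \<omega>) * indicator A (m (Y \<omega>) + E \<omega>) \<partial>M)"
        unfolding set_lebesgue_integral_def G
        by (intro Bochner_Integration.integral_cong) (auto simp: X indicator_def)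
      also have "\<dots> = (\<integral>(z, y). indicator B y * indicator A (m y + z) \<partial>distr M (borel \<Otimes>\<^sub>M L) (\<lambda>\<omega>. (E \<omega>, Y \<omega>)))"
        unfolding split_beta' by (subst integral_distr) auto
      also have "distr M (borel \<Otimes>\<^sub>M L) (\<lambda>\<omega>. (E \<omega>, Y \<omega>)) = ?\<mu> \<Otimes>\<^sub>M ?\<nu>"
        using indep by (simp add: indep_rv_def)
      also have "(\<integral>(z, y). indicat_real B y * indicator A (m y + z) \<partial>(?\<mu> \<Otimes>\<^sub>M ?\<nu>))
          = (\<integral>y. (\<integral>z. indicat_real B y * indicator A (m y + z) \<partial>?\<mu>) \<partial>?\<nu>)"
      proof -
        have "integrable (?\<mu> \<Otimes>\<^sub>M ?\<nu>) (\<lambda>(z, y). indicat_real B y * indicator A (m y + z))"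
          by (rule P.P.integrable_const_bound[of _ 1]) (auto simp: split_beta' indicator_def)
        from P.integral_snd[OF this] show ?thesis ..
      qed
      also have "\<dots> = (\<integral>y. indicator B y * measure (\<kappa> y) A \<partial>?\<nu>)"
      proof (rule Bochner_Integration.integral_cong[OF refl])
        fix y assume "y \<in> space ?\<nu>"
        then have y: "y \<in> space L" by simp
        have "(\<integral>z. indicat_real A (m y + z) \<partial>?\<mu>) = (\<integral>z. indicat_real A z \<partial>\<kappa> y)"
          unfolding \<kappa>'[OF y] by (subst integral_distr) auto
        also have "\<dots> = measure (\<kappa> y) A" unfolding \<kappa>'[OF y] by simp
        finally show "(\<integral>z. indicator B y * indicator A (m y + z) \<partial>?\<mu>) = indicator B y * measure (\<kappa> y) A" by simp
      qed
      also have "\<dots> = (\<integral>\<omega>. indicator B (Y \<omega>) * measure (\<kappa> (Y \<omega>)) A \<partial>M)"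
        by (subst integral_distr) auto
      also have "\<dots> = (\<integral>\<omega>\<in>G. measure (\<kappa> (Y \<omega>)) A \<partial>M)"
        unfolding set_lebesgue_integral_def G
        by (intro Bochner_Integration.integral_cong) (auto simp: indicator_def)
      finally show "(\<integral>\<omega>\<in>G. indicat_real (X -` A \<inter> space M) \<omega> \<partial>M) = (\<integral>\<omega>\<in>G. measure (\<kappa> (Y \<omega>)) A \<partial>M)" .
    qed
    then show ?thesis by eventually_elim simp
  qed
  then show ?thesis
    using X_meas \<kappa>_meas by (auto simp: regular_cond_distr_def)
qed

section \<open>Rules for replacing, translating and freezing random variables\<close>

lemma rv_events_subset_Pow: "rv_events M X \<subseteq> Pow (space M)"
  by (auto simp: rv_events_def)

text \<open>The model equations hold on the sample space only, so they are transferred by congruence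
  rather than by equality of functions.\<close>

lemma moments_cong:
  assumes "\<And>\<omega>. \<omega> \<in> space M \<Longrightarrow> X \<omega> = Z \<omega>"
  shows finite_second_moment_cong: "finite_second_moment M X = finite_second_moment M Z"
    and mean_vec_cong: "mean_vec M X = mean_vec M Z"
    and cov_mat_cong: "cov_mat M X = cov_mat M Z"
proof -
  have "X \<in> borel_measurable M \<longleftrightarrow> Z \<in> borel_measurable M"
    using assms by (rule measurable_cong)
  moreover have "integrable M (\<lambda>\<omega>. (norm (X \<omega>))\<^sup>2) \<longleftrightarrow> integrable M (\<lambda>\<omega>. (norm (Z \<omega>))\<^sup>2)"
    using assms by (intro Bochner_Integration.integrable_cong) auto
  ultimately show "finite_second_moment M X = finite_second_moment M Z"
    by (simp add: finite_second_moment_def)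
  show mean: "mean_vec M X = mean_vec M Z"
    unfolding mean_vec_def using assms by (rule Bochner_Integration.integral_cong[OF refl])
  show "cov_mat M X = cov_mat M Z"
    unfolding cov_mat_def mean vec_eq_iff
    using assms by (auto intro!: Bochner_Integration.integral_cong)
qed

lemma (in prob_space) translation_moments:
  assumes "finite_second_moment M X"
  shows finite_second_moment_translation: "finite_second_moment M (\<lambda>\<omega>. c + X \<omega>)"
    and mean_vec_translation: "mean_vec M (\<lambda>\<omega>. c + X \<omega>) = c + mean_vec M X"
    and cov_mat_translation: "cov_mat M (\<lambda>\<omega>. c + X \<omega>) = cov_mat M X"
  using affine_moments[OF assms, of c "mat 1"] by simp_all

lemma (in prob_space) cov_mat_mult:
  fixes A :: "real^'n^'m"
  assumes "finite_second_moment M X"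
  shows "cov_mat M (\<lambda>\<omega>. A *v X \<omega>) = A ** cov_mat M X ** transpose A"
  using cov_mat_affine[OF assms, of 0 A] by simp

lemma cis_gaussian_cong:
  assumes "\<And>\<omega>. \<omega> \<in> space M \<Longrightarrow> X \<omega> = Z \<omega>"
  shows "cis_gaussian M X P = cis_gaussian M Z P"
proof -
  have "X \<in> borel_measurable M \<longleftrightarrow> Z \<in> borel_measurable M"
    using assms by (rule measurable_cong)
  moreover have "(\<integral>\<omega>. cis (t \<bullet> X \<omega>) \<partial>M) = (\<integral>\<omega>. cis (t \<bullet> Z \<omega>) \<partial>M)" for t
    using assms by (intro Bochner_Integration.integral_cong) auto
  ultimately show ?thesis by (simp add: cis_gaussian_def)
qed

lemma indep_rv_cong:
  assumes "\<And>\<omega>. \<omega> \<in> space M \<Longrightarrow> X \<omega> = X' \<omega>" "\<And>\<omega>. \<omega> \<in> space M \<Longrightarrow> Z \<omega> = Z' \<omega>"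
  shows "indep_rv M S X T Z = indep_rv M S X' T Z'"
proof -
  have "X \<in> measurable M S \<longleftrightarrow> X' \<in> measurable M S" "Z \<in> measurable M T \<longleftrightarrow> Z' \<in> measurable M T"
    using assms by (auto intro!: measurable_cong)
  moreover have "distr M S X = distr M S X'" "distr M T Z = distr M T Z'"
    "distr M (S \<Otimes>\<^sub>M T) (\<lambda>\<omega>. (X \<omega>, Z \<omega>)) = distr M (S \<Otimes>\<^sub>M T) (\<lambda>\<omega>. (X' \<omega>, Z' \<omega>))"
    using assms by (auto intro!: distr_cong)
  ultimately show ?thesis by (simp add: indep_rv_def)
qed

lemma (in prob_space) indep_rv_const:
  assumes "X \<in> measurable M S" "c \<in> space T"
  shows "indep_rv M S X T (\<lambda>_. c)"
proof (rule indep_rvI)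
  show "emeasure M (X -` A \<inter> space M \<inter> ((\<lambda>_. c) -` B \<inter> space M))
     = emeasure M (X -` A \<inter> space M) * emeasure M ((\<lambda>_. c) -` B \<inter> space M)" for A B
    by (cases "c \<in> B") (simp_all add: Int_absorb2 emeasure_space_1)
qed (use assms in auto)

section \<open>The Kalman recursion and the mean-field process\<close>

text \<open>The deterministic recursion by itself. Both processes are built over it, with the same
  initial mean and covariance, and therefore share the same means and covariances.\<close>

locale kalman =
  fixes B Q :: "real^'d^'d" and H :: "real^'d^'q" and R :: "real^'q^'q"
    and m0 :: "real^'d" and P0 :: "real^'d^'d"
begin

primrec acov :: "nat \<Rightarrow> real^'d^'d" where
  "acov 0 = P0"
| "acov (Suc k) = (mat 1 - kalman_gain H R (B ** acov k ** transpose B + Q) ** H)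
     ** (B ** acov k ** transpose B + Q)"

text \<open>Index shift: \<open>fcov k\<close> is the forecast covariance of time k + 1.\<close>

definition fcov :: "nat \<Rightarrow> real^'d^'d" where
  "fcov k = B ** acov k ** transpose B + Q"

text \<open>The analysis mean as a function of an observation path, to be evaluated at a fixed path
  in the mean-field process and at the random observations in the filter.\<close>

primrec amean :: "(nat \<Rightarrow> real^'q) \<Rightarrow> nat \<Rightarrow> real^'d" where
  "amean y 0 = m0"
| "amean y (Suc k) = B *v amean y k
     + kalman_gain H R (fcov k) *v (y (Suc k) - H *v (B *v amean y k))"

lemma acov_Suc: "acov (Suc k) = (mat 1 - kalman_gain H R (fcov k) ** H) ** fcov k"
  by (simp add: fcov_def)

lemma amean_cong:
  assumes "\<And>j. j \<in> {1..k} \<Longrightarrow> y j = y' j"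
  shows "amean y k = amean y' k"
  using assms by (induction k) auto

text \<open>The index set \<open>I\<close> stays fixed while k varies: the induction step needs the
  mean of time k on a product space that also carries coordinate k + 1.\<close>

lemma measurable_amean:
  assumes "{1..k} \<subseteq> I"
  shows "(\<lambda>y. amean y k) \<in> borel_measurable (Pi\<^sub>M I (\<lambda>_. borel))"
  using assms
proof (induction k)
  case (Suc k)
  then have [measurable]: "(\<lambda>y. amean y k) \<in> borel_measurable (Pi\<^sub>M I (\<lambda>_. borel))"
    by (intro Suc.IH) (auto simp: subset_iff)
  have [measurable]: "(\<lambda>y. y (Suc k)) \<in> borel_measurable (Pi\<^sub>M I (\<lambda>_. borel))"
    using Suc.prems by (intro measurable_component_singleton) auto
  show ?case by simp
qed simp

end

locale mean_field = prob_space N + kalman B "C ** transpose C" H R "mean_vec N Xa0" "cov_mat N Xa0"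
  for N :: "'b measure" and B :: "real^'d^'d" and C :: "real^'w^'d" and H :: "real^'d^'q"
    and R :: "real^'q^'q" and Xa0 :: "'b \<Rightarrow> real^'d" +
  fixes T :: "real^'d^'d \<Rightarrow> real^'d^'d" and W :: "nat \<Rightarrow> 'b \<Rightarrow> real^'w"
    and Xf Xa :: "(nat \<Rightarrow> real^'q) \<Rightarrow> nat \<Rightarrow> 'b \<Rightarrow> real^'d"
  assumes T_consistent: "\<And>P. pos_semidef P \<Longrightarrow>
      T P ** P ** transpose (T P) = (mat 1 - kalman_gain H R P ** H) ** P"
    and Xa0_moment: "finite_second_moment N Xa0"
    and W_gauss: "\<And>k. k \<ge> 1 \<Longrightarrow> distributed N lborel (W k) std_gaussian_density"
    and indep: "indep_init_noise N Xa0 W"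
    and Xa_init: "\<And>y \<omega>. \<omega> \<in> space N \<Longrightarrow> Xa y 0 \<omega> = Xa0 \<omega>"
    and Xf_step: "\<And>y k \<omega>. k \<ge> 1 \<Longrightarrow> \<omega> \<in> space N \<Longrightarrow>
      Xf y k \<omega> = B *v Xa y (k - 1) \<omega> + C *v W k \<omega>"
    and Xa_step: "\<And>y k \<omega>. k \<ge> 1 \<Longrightarrow> \<omega> \<in> space N \<Longrightarrow>
      Xa y k \<omega> =
        (mean_vec N (Xf y k)
          + kalman_gain H R (cov_mat N (Xf y k)) *v (y k - H *v mean_vec N (Xf y k)))
        + T (cov_mat N (Xf y k)) *v (Xf y k \<omega> - mean_vec N (Xf y k))"
begin

text \<open>The covariances do not depend on the observations, so the deviation of \<open>Xa y k\<close> from its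
  mean is the same random variable for every \<open>y\<close>.\<close>

primrec dev :: "nat \<Rightarrow> 'b \<Rightarrow> real^'d" where
  "dev 0 \<omega> = - mean_vec N Xa0 + Xa0 \<omega>"
| "dev (Suc k) \<omega> = T (fcov k) *v (B *v dev k \<omega> + C *v W (Suc k) \<omega>)"

text \<open>The deviation of the forecast of time k + 1, with the index shift of
  \<open>fcov\<close>.\<close>

definition fdev :: "nat \<Rightarrow> 'b \<Rightarrow> real^'d" where
  "fdev k \<omega> = B *v dev k \<omega> + C *v W (Suc k) \<omega>"

abbreviation gens :: "nat \<Rightarrow> 'b set set" where
  "gens i \<equiv> if i = 0 then rv_events N Xa0 else rv_events N (W i)"

lemma gens_subset_Pow: "(\<Union>i\<in>J. gens i) \<subseteq> Pow (space N)"
  by (intro UN_least) (simp add: rv_events_subset_Pow)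

text \<open>Records that the deviation is built from the initial value and the noises up to time k,
  hence from a block that avoids the next noise.\<close>

lemma measurable_dev:
  assumes "{..k} \<subseteq> J"
  shows "dev k \<in> borel_measurable (sigma (space N) (\<Union>i\<in>J. gens i))"
  using assms
proof (induction k)
  case 0
  then have [measurable]: "Xa0 \<in> borel_measurable (sigma (space N) (\<Union>i\<in>J. gens i))"
    by (intro measurable_sigma_rv_events[where i=0] gens_subset_Pow) auto
  show ?case unfolding dev.simps(1)[abs_def] by measurable
next
  case (Suc k)
  then have [measurable]: "dev k \<in> borel_measurable (sigma (space N) (\<Union>i\<in>J. gens i))"
    by (intro Suc.IH) (auto simp: subset_iff)
  have [measurable]: "W (Suc k) \<in> borel_measurable (sigma (space N) (\<Union>i\<in>J. gens i))"
    using Suc.prems by (intro measurable_sigma_rv_events[where i="Suc k"] gens_subset_Pow) auto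
  show ?case unfolding dev.simps(2)[abs_def] by measurable
qed

lemma indep_dev_W: "indep_rv N borel (dev k) borel (W (Suc k))"
proof (rule indep_sets_imp_indep_rv)
  show "indep_sets gens UNIV" using indep by (simp add: indep_init_noise_def)
  show "dev k \<in> borel_measurable (sigma (space N) (\<Union>i\<in>{..k}. gens i))"
    by (rule measurable_dev) simp
  show "W (Suc k) \<in> borel_measurable (sigma (space N) (\<Union>i\<in>{Suc k}. gens i))"
    by (rule measurable_sigma_rv_events[where i="Suc k"]) (use gens_subset_Pow in auto)
qed (auto simp: Int_stable_rv_events)

lemma indep_mult_dev_W: "indep_rv N borel (\<lambda>\<omega>. B *v dev k \<omega>) borel (\<lambda>\<omega>. C *v W (Suc k) \<omega>)"
  by (rule indep_rv_compose[OF indep_dev_W]) measurable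

text \<open>Stated conditionally because it serves inside the induction that establishes its
  hypotheses.\<close>

lemma fdev_moments_of_dev:
  assumes dev: "finite_second_moment N (dev k)" "mean_vec N (dev k) = 0" "cov_mat N (dev k) = acov k"
  shows "finite_second_moment N (fdev k)" "mean_vec N (fdev k) = 0" "cov_mat N (fdev k) = fcov k"
proof -
  note W = distributed_std_gaussian_moments[OF W_gauss[of "Suc k"], simplified]
  note fsm = finite_second_moment_mult[OF dev(1), of B] finite_second_moment_mult[OF W(1), of C]
  show "finite_second_moment N (fdev k)"
    unfolding fdev_def[abs_def] by (intro finite_second_moment_add fsm)
  show "mean_vec N (fdev k) = 0"
    unfolding fdev_def[abs_def] mean_vec_add[OF fsm] by (simp add: mean_vec_mult dev W)
  show "cov_mat N (fdev k) = fcov k"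
    unfolding fdev_def[abs_def] fcov_def cov_mat_add_indep[OF fsm indep_mult_dev_W]
    by (simp add: cov_mat_mult dev W)
qed

lemma dev_moments:
  "finite_second_moment N (dev k) \<and> mean_vec N (dev k) = 0 \<and> cov_mat N (dev k) = acov k"
proof (induction k)
  case 0
  show ?case
    using translation_moments[OF Xa0_moment, of "- mean_vec N Xa0"] by (simp add: dev.simps(1)[abs_def])
next
  case (Suc k)
  then have fdev: "finite_second_moment N (fdev k)" "mean_vec N (fdev k) = 0" "cov_mat N (fdev k) = fcov k"
    by (auto intro!: fdev_moments_of_dev)
  \<comment> \<open>Consistency of \<open>T\<close> is granted for semidefinite arguments;
    \<open>fcov k\<close> is one because it is the covariance of \<open>fdev k\<close>.\<close>
  have "pos_semidef (fcov k)"
    using pos_semidef_cov_mat[OF fdev(1)] by (simp add: fdev)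
  moreover have "dev (Suc k) = (\<lambda>\<omega>. T (fcov k) *v fdev k \<omega>)"
    by (simp add: fun_eq_iff fdev_def)
  ultimately show ?case
    unfolding acov_Suc
    by (simp add: finite_second_moment_mult mean_vec_mult cov_mat_mult fdev T_consistent)
qed

lemma fdev_moments:
  "finite_second_moment N (fdev k)" "mean_vec N (fdev k) = 0" "cov_mat N (fdev k) = fcov k"
  using dev_moments by (auto intro!: fdev_moments_of_dev)

lemma pos_semidef_fcov: "pos_semidef (fcov k)"
  using pos_semidef_cov_mat[OF fdev_moments(1)[of k]] by (simp add: fdev_moments)

text \<open>\<open>T\<close> is evaluated at a deterministic matrix, so each update of the deviation
  is linear and preserves Gaussianity; consistency of \<open>T\<close> turns the new parameter T P
  T^T into the Kalman covariance.\<close>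

lemma cis_gaussian_dev:
  assumes "cis_gaussian N (dev 0) (acov 0)"
  shows "cis_gaussian N (dev k) (acov k)"
proof (induction k)
  case (Suc k)
  have "cis_gaussian N (fdev k) (B ** acov k ** transpose B + C ** mat 1 ** transpose C)"
    unfolding fdev_def[abs_def]
    by (intro cis_gaussian_add_indep cis_gaussian_mult Suc distributed_std_gaussian_cis_gaussian
        W_gauss indep_mult_dev_W) simp
  then have "cis_gaussian N (fdev k) (fcov k)" by (simp add: fcov_def)
  from cis_gaussian_mult[OF this, of "T (fcov k)"] show ?case
    unfolding acov_Suc by (simp add: T_consistent pos_semidef_fcov fdev_def dev.simps(2)[abs_def])
qed (rule assms)

text \<open>Conditional for the same reason as \<open>fdev_moments_of_dev\<close>: the update
  formula contains the forecast moments, so the representation of \<open>Xa\<close> and these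
  moments advance together.\<close>

lemma Xf_moments_of_Xa:
  assumes "\<And>\<omega>. \<omega> \<in> space N \<Longrightarrow> Xa y k \<omega> = amean y k + dev k \<omega>"
  shows "\<And>\<omega>. \<omega> \<in> space N \<Longrightarrow> Xf y (Suc k) \<omega> = B *v amean y k + fdev k \<omega>"
    and "finite_second_moment N (Xf y (Suc k))"
    and "mean_vec N (Xf y (Suc k)) = B *v amean y k"
    and "cov_mat N (Xf y (Suc k)) = fcov k"
proof -
  show *: "Xf y (Suc k) \<omega> = B *v amean y k + fdev k \<omega>" if "\<omega> \<in> space N" for \<omega>
    using that by (simp add: Xf_step assms fdev_def matrix_vector_right_distrib add.assoc)
  show "finite_second_moment N (Xf y (Suc k))"
    by (subst finite_second_moment_cong[OF *]) (simp_all add: translation_moments fdev_moments)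
  show "mean_vec N (Xf y (Suc k)) = B *v amean y k"
    by (subst mean_vec_cong[OF *]) (simp_all add: translation_moments fdev_moments)
  show "cov_mat N (Xf y (Suc k)) = fcov k"
    by (subst cov_mat_cong[OF *]) (simp_all add: translation_moments fdev_moments)
qed

text \<open>The update sets a new mean and applies \<open>T\<close> to the forecast deviation. As
  the matrix inserted in \<open>T\<close> is \<open>fcov k\<close> for every path, \<open>y\<close>
  influences the mean only.\<close>

lemma Xa_eq: "\<omega> \<in> space N \<Longrightarrow> Xa y k \<omega> = amean y k + dev k \<omega>"
proof (induction k arbitrary: \<omega>)
  case 0
  then show ?case by (simp add: Xa_init)
next
  case (Suc k)
  note Xf = Xf_moments_of_Xa[OF Suc.IH]
  show ?case
    using Suc.prems by (simp add: Xa_step Xf fdev_def)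
qed

lemmas Xf_moments = Xf_moments_of_Xa(2-4)[OF Xa_eq]

lemma Xa_moments:
  "finite_second_moment N (Xa y k)" "mean_vec N (Xa y k) = amean y k" "cov_mat N (Xa y k) = acov k"
  using dev_moments[of k]
  by (subst moments_cong[OF Xa_eq]; simp add: translation_moments)+

end

section \<open>The filtering model\<close>

text \<open>The last two assumptions connect the filter with the mean-field process: the first comes
  from the common initial law, the second is supplied by the covariances of the mean-field
  forecasts.\<close>

locale linear_model = prob_space M + kalman B "C ** transpose C" H "\<Gamma> ** transpose \<Gamma>" m0 P0
  for M :: "'a measure" and B :: "real^'d^'d" and C :: "real^'w^'d" and H :: "real^'d^'q"
    and \<Gamma> :: "real^'v^'q" and m0 :: "real^'d" and P0 :: "real^'d^'d" +
  fixes X :: "nat \<Rightarrow> 'a \<Rightarrow> real^'d" and Y :: "nat \<Rightarrow> 'a \<Rightarrow> real^'q"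
    and W :: "nat \<Rightarrow> 'a \<Rightarrow> real^'w" and V :: "nat \<Rightarrow> 'a \<Rightarrow> real^'v"
  assumes R_pos: "pos_def (\<Gamma> ** transpose \<Gamma>)"
    and W_gauss: "\<And>k. k \<ge> 1 \<Longrightarrow> distributed M lborel (W k) std_gaussian_density"
    and V_gauss: "\<And>k. k \<ge> 1 \<Longrightarrow> distributed M lborel (V k) std_gaussian_density"
    and indep: "indep_init_noises M (X 0) W V"
    and X_step: "\<And>k \<omega>. k \<ge> 1 \<Longrightarrow> \<omega> \<in> space M \<Longrightarrow> X k \<omega> = B *v X (k - 1) \<omega> + C *v W k \<omega>"
    and Y_obs: "\<And>k \<omega>. k \<ge> 1 \<Longrightarrow> \<omega> \<in> space M \<Longrightarrow> Y k \<omega> = H *v X k \<omega> + \<Gamma> *v V k \<omega>"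
    and X0_gauss: "cis_gaussian M (\<lambda>\<omega>. X 0 \<omega> - m0) P0"
    and pos_semidef_fcov: "\<And>k. pos_semidef (fcov k)"
begin

abbreviation gens :: "nat + nat \<Rightarrow> 'a set set" where
  "gens \<equiv> case_sum (\<lambda>k. if k = 0 then rv_events M (X 0) else rv_events M (W k)) (\<lambda>k. rv_events M (V k))"

abbreviation sigma_gens :: "(nat + nat) set \<Rightarrow> 'a measure" where
  "sigma_gens J \<equiv> sigma (space M) (\<Union>i\<in>J. gens i)"

abbreviation obs :: "nat \<Rightarrow> 'a \<Rightarrow> nat \<Rightarrow> real^'q" where
  "obs k \<omega> \<equiv> \<lambda>j\<in>{1..k}. Y j \<omega>"

abbreviation obs_space :: "nat \<Rightarrow> (nat \<Rightarrow> real^'q) measure" where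
  "obs_space k \<equiv> Pi\<^sub>M {1..k} (\<lambda>_. borel)"

definition err :: "nat \<Rightarrow> 'a \<Rightarrow> real^'d" where
  "err k \<omega> = X k \<omega> - amean (obs k \<omega>) k"

definition ferr :: "nat \<Rightarrow> 'a \<Rightarrow> real^'d" where
  "ferr k \<omega> = B *v err k \<omega> + C *v W (Suc k) \<omega>"

text \<open>The innovation of time k + 1, written in terms of the errors so that it is visibly
  linear in them and in the noise; \<open>Y_Suc_eq\<close> shows that it is the observation minus
  its forecast.\<close>

definition innov :: "nat \<Rightarrow> 'a \<Rightarrow> real^'q" where
  "innov k \<omega> = H *v ferr k \<omega> + \<Gamma> *v V (Suc k) \<omega>"

lemma gens_subset_Pow: "(\<Union>i\<in>J. gens i) \<subseteq> Pow (space M)"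
  using rv_events_subset_Pow[of M "X 0"] rv_events_subset_Pow[of M "W _"] rv_events_subset_Pow[of M "V _"]
  by (intro UN_least) (simp split: sum.split)

lemma measurable_W_sigma_gens:
  assumes "k \<ge> 1" "Inl k \<in> J"
  shows "W k \<in> borel_measurable (sigma_gens J)"
  using assms by (intro measurable_sigma_rv_events[where i="Inl k"] gens_subset_Pow) auto

lemma measurable_V_sigma_gens:
  assumes "Inr k \<in> J"
  shows "V k \<in> borel_measurable (sigma_gens J)"
  using assms by (intro measurable_sigma_rv_events[where i="Inr k"] gens_subset_Pow) auto

lemma space_sigma_gens: "space (sigma_gens J) = space M"
  by (simp add: space_measure_of_conv)

lemma measurable_X_sigma_gens:
  assumes "\<And>j. j \<le> k \<Longrightarrow> Inl j \<in> J"
  shows "X k \<in> borel_measurable (sigma_gens J)"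
  using assms
proof (induction k)
  case 0
  then show ?case
    by (intro measurable_sigma_rv_events[where i="Inl 0"] gens_subset_Pow) auto
next
  case (Suc k)
  have [measurable]: "X k \<in> borel_measurable (sigma_gens J)"
    by (intro Suc.IH Suc.prems) simp
  have [measurable]: "W (Suc k) \<in> borel_measurable (sigma_gens J)"
    by (intro measurable_W_sigma_gens Suc.prems) simp_all
  have "X (Suc k) \<omega> = B *v X k \<omega> + C *v W (Suc k) \<omega>" if "\<omega> \<in> space (sigma_gens J)" for \<omega>
    using that X_step[of "Suc k"] unfolding space_sigma_gens by simp
  then show ?case by (subst measurable_cong) measurable
qed

lemma measurable_obs_sigma_gens:
  assumes "\<And>j. j \<le> k \<Longrightarrow> Inl j \<in> J" "\<And>j. 1 \<le> j \<Longrightarrow> j \<le> k \<Longrightarrow> Inr j \<in> J"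
  shows "obs k \<in> measurable (sigma_gens J) (obs_space k)"
proof (rule measurable_restrict)
  fix j assume j: "j \<in> {1..k}"
  have [measurable]: "X j \<in> borel_measurable (sigma_gens J)" "V j \<in> borel_measurable (sigma_gens J)"
    using j by (auto intro!: measurable_X_sigma_gens measurable_V_sigma_gens assms)
  have "Y j \<omega> = H *v X j \<omega> + \<Gamma> *v V j \<omega>" if "\<omega> \<in> space (sigma_gens J)" for \<omega>
    using that j Y_obs[of j] unfolding space_sigma_gens by simp
  then show "Y j \<in> borel_measurable (sigma_gens J)" by (subst measurable_cong) measurable
qed

lemma measurable_err_sigma_gens:
  assumes "\<And>j. j \<le> k \<Longrightarrow> Inl j \<in> J" "\<And>j. 1 \<le> j \<Longrightarrow> j \<le> k \<Longrightarrow> Inr j \<in> J"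
  shows "err k \<in> borel_measurable (sigma_gens J)"
proof -
  have [measurable]: "X k \<in> borel_measurable (sigma_gens J)"
    using assms(1) by (rule measurable_X_sigma_gens)
  have "(\<lambda>\<omega>. amean (obs k \<omega>) k) \<in> borel_measurable (sigma_gens J)"
    by (rule measurable_compose[OF measurable_obs_sigma_gens[OF assms] measurable_amean]) auto
  then show ?thesis unfolding err_def[abs_def] by measurable
qed

lemma indep_sigma_gens:
  assumes "J1 \<subseteq> UNIV <+> {1..}" "J2 \<subseteq> UNIV <+> {1..}" "J1 \<inter> J2 = {}"
    and "U \<in> measurable (sigma_gens J1) S" "Z \<in> measurable (sigma_gens J2) S'"
  shows "indep_rv M S U S' Z"
proof (rule indep_sets_imp_indep_rv[OF _ _ assms])
  show "indep_sets gens (UNIV <+> {1..})" using indep by (simp add: indep_init_noises_def)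
  show "Int_stable (gens i)" for i by (simp add: Int_stable_rv_events split: sum.split)
qed

lemma indep_past_W: "indep_rv M (borel \<Otimes>\<^sub>M obs_space k) (\<lambda>\<omega>. (err k \<omega>, obs k \<omega>)) borel (W (Suc k))"
proof (rule indep_sigma_gens[where ?J1.0="Inl ` {..k} \<union> Inr ` {1..k}" and ?J2.0="{Inl (Suc k)}"])
  show "(\<lambda>\<omega>. (err k \<omega>, obs k \<omega>)) \<in> measurable (sigma_gens (Inl ` {..k} \<union> Inr ` {1..k})) (borel \<Otimes>\<^sub>M obs_space k)"
    by (intro measurable_Pair measurable_err_sigma_gens measurable_obs_sigma_gens) auto
  show "W (Suc k) \<in> borel_measurable (sigma_gens {Inl (Suc k)})"
    by (rule measurable_W_sigma_gens) simp_all
qed auto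

text \<open>Within a time step the model noise acts before the observation noise, so the first block
  already contains index k + 1 on the left but stops at k on the right.\<close>

lemma indep_past_V: "indep_rv M (borel \<Otimes>\<^sub>M obs_space k) (\<lambda>\<omega>. (ferr k \<omega>, obs k \<omega>)) borel (V (Suc k))"
proof (rule indep_sigma_gens[where ?J1.0="Inl ` {..Suc k} \<union> Inr ` {1..k}" and ?J2.0="{Inr (Suc k)}"])
  let ?J = "Inl ` {..Suc k} \<union> Inr ` {1..k}"
  have [measurable]: "err k \<in> borel_measurable (sigma_gens ?J)" "W (Suc k) \<in> borel_measurable (sigma_gens ?J)"
    by (intro measurable_err_sigma_gens measurable_W_sigma_gens; auto)+
  have "ferr k \<in> borel_measurable (sigma_gens ?J)" unfolding ferr_def[abs_def] by measurable
  then show "(\<lambda>\<omega>. (ferr k \<omega>, obs k \<omega>)) \<in> measurable (sigma_gens ?J) (borel \<Otimes>\<^sub>M obs_space k)"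
    by (intro measurable_Pair measurable_obs_sigma_gens) auto
  show "V (Suc k) \<in> borel_measurable (sigma_gens {Inr (Suc k)})"
    by (rule measurable_V_sigma_gens) simp
qed auto

lemma amean_obs_Suc: "amean (obs (Suc k) \<omega>) k = amean (obs k \<omega>) k"
  by (rule amean_cong) auto

lemma Y_Suc_eq: "\<omega> \<in> space M \<Longrightarrow> Y (Suc k) \<omega> = H *v (B *v amean (obs k \<omega>) k) + innov k \<omega>"
  by (simp add: Y_obs X_step innov_def ferr_def err_def algebra_simps)

text \<open>Subtracting the mean recursion from the state equation cancels the mean itself. What
  remains is linear in the forecast error and the innovation, the form required by
  \<open>kalman_update_errors\<close>.\<close>

lemma err_Suc_eq:
  assumes "\<omega> \<in> space M"
  shows "err (Suc k) \<omega> = ferr k \<omega> - kalman_gain H (\<Gamma> ** transpose \<Gamma>) (fcov k) *v innov k \<omega>"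
proof -
  have "err (Suc k) \<omega> = X (Suc k) \<omega> - (B *v amean (obs k \<omega>) k
      + kalman_gain H (\<Gamma> ** transpose \<Gamma>) (fcov k) *v (Y (Suc k) \<omega> - H *v (B *v amean (obs k \<omega>) k)))"
    using amean_obs_Suc[of \<omega> k] by (simp add: err_def)
  also have "X (Suc k) \<omega> = B *v amean (obs k \<omega>) k + ferr k \<omega>"
    using assms by (simp add: X_step ferr_def err_def algebra_simps)
  also have "Y (Suc k) \<omega> - H *v (B *v amean (obs k \<omega>) k) = innov k \<omega>"
    using assms by (simp add: Y_Suc_eq)
  finally show ?thesis by simp
qed

text \<open>The new observation vector is a measurable function of the previous one and the innovation,
  and the analysis error is independent of both.\<close>

lemma err_step:
  assumes gauss: "cis_gaussian M (err k) (acov k)" and ind: "indep_rv M borel (err k) (obs_space k) (obs k)"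
  shows "cis_gaussian M (err (Suc k)) (acov (Suc k))"
    and "indep_rv M borel (err (Suc k)) (obs_space (Suc k)) (obs (Suc k))"
proof -
  let ?K = "kalman_gain H (\<Gamma> ** transpose \<Gamma>) (fcov k)"
  have "indep_rv M borel (\<lambda>\<omega>. fst (err k \<omega>, obs k \<omega>)) borel (\<lambda>\<omega>. W (Suc k) \<omega>)"
    by (rule indep_rv_compose[OF indep_past_W]) measurable
  then have "indep_rv M borel (err k) borel (W (Suc k))" by simp
  then have "indep_rv M borel (\<lambda>\<omega>. B *v err k \<omega>) borel (\<lambda>\<omega>. C *v W (Suc k) \<omega>)"
    by (rule indep_rv_compose) measurable
  then have "cis_gaussian M (ferr k) (B ** acov k ** transpose B + C ** mat 1 ** transpose C)"
    unfolding ferr_def[abs_def]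
    by (intro cis_gaussian_add_indep cis_gaussian_mult gauss distributed_std_gaussian_cis_gaussian W_gauss) simp
  then have ferr: "cis_gaussian M (ferr k) (fcov k)" by (simp add: fcov_def)
  have V: "cis_gaussian M (V (Suc k)) (mat 1)"
    by (intro distributed_std_gaussian_cis_gaussian V_gauss) simp
  have "indep_rv M borel (\<lambda>\<omega>. fst (ferr k \<omega>, obs k \<omega>)) borel (\<lambda>\<omega>. V (Suc k) \<omega>)"
    by (rule indep_rv_compose[OF indep_past_V]) measurable
  then have ferr_V: "indep_rv M borel (ferr k) borel (V (Suc k))" by simp
  \<comment> \<open>The model noise joins the error, while the pair stays independent of the past
    observations.\<close>
  have "indep_rv M (borel \<Otimes>\<^sub>M borel) (\<lambda>\<omega>. (err k \<omega>, W (Suc k) \<omega>)) (obs_space k) (obs k)"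
    by (rule indep_rv_exchange[OF ind indep_past_W])
  then have "indep_rv M borel (\<lambda>\<omega>. (\<lambda>(e, w). B *v e + C *v w) (err k \<omega>, W (Suc k) \<omega>)) (obs_space k) (\<lambda>\<omega>. (obs k \<omega>))"
    by (rule indep_rv_compose) measurable
  then have "indep_rv M borel (ferr k) (obs_space k) (obs k)" by (simp add: ferr_def[abs_def])
  then have ferrV_obs: "indep_rv M (borel \<Otimes>\<^sub>M borel) (\<lambda>\<omega>. (ferr k \<omega>, V (Suc k) \<omega>)) (obs_space k) (obs k)"
    by (rule indep_rv_exchange[OF _ indep_past_V])
  have innov: "(\<lambda>\<omega>. H *v ferr k \<omega> + \<Gamma> *v V (Suc k) \<omega>) = innov k" by (simp add: fun_eq_iff innov_def)
  note upd = kalman_update_errors[OF ferr V ferr_V R_pos pos_semidef_fcov, of H, folded innov_def, unfolded innov]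
  have err: "cis_gaussian M (err (Suc k)) (acov (Suc k)) \<longleftrightarrow> cis_gaussian M (\<lambda>\<omega>. ferr k \<omega> - ?K *v innov k \<omega>) (acov (Suc k))"
    by (rule cis_gaussian_cong[OF err_Suc_eq])
  then show "cis_gaussian M (err (Suc k)) (acov (Suc k))"
    using upd(1) by (simp only: acov_Suc)
  have err_innov: "indep_rv M borel (innov k) borel (err (Suc k))"
  proof (rule indep_rv_swap)
    show "indep_rv M borel (err (Suc k)) borel (innov k)"
      using upd(2) by (subst indep_rv_cong[OF err_Suc_eq refl])
  qed
  \<comment> \<open>Innovation and new error are functions of the forecast error and
    \<open>V (Suc k)\<close>, hence jointly independent of the past observations. As they are also
    independent of each other, the past observations can be regrouped with the innovation.\<close>
  have "indep_rv M (borel \<Otimes>\<^sub>M borel)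
      (\<lambda>\<omega>. (\<lambda>(f, v). (H *v f + \<Gamma> *v v, f - ?K *v (H *v f + \<Gamma> *v v))) (ferr k \<omega>, V (Suc k) \<omega>))
      (obs_space k) (\<lambda>\<omega>. (obs k \<omega>))"
    by (rule indep_rv_compose[OF ferrV_obs]) measurable
  then have "indep_rv M (borel \<Otimes>\<^sub>M borel) (\<lambda>\<omega>. (innov k \<omega>, err (Suc k) \<omega>)) (obs_space k) (obs k)"
    by (subst indep_rv_cong[OF _ refl]) (auto simp: innov_def err_Suc_eq)
  then have "indep_rv M (borel \<Otimes>\<^sub>M obs_space k) (\<lambda>\<omega>. (innov k \<omega>, obs k \<omega>)) borel (err (Suc k))"
    by (rule indep_rv_exchange[OF err_innov])
  then have innov_obs: "indep_rv M borel (err (Suc k)) (borel \<Otimes>\<^sub>M obs_space k) (\<lambda>\<omega>. (innov k \<omega>, obs k \<omega>))"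
    by (rule indep_rv_swap)
  \<comment> \<open>Rebuilds the observation vector: the last entry is the forecast observation plus
    the innovation, the others are copied.\<close>
  define h where "h p = (\<lambda>j\<in>{1..Suc k}. if j = Suc k then H *v (B *v amean (snd p) k) + fst p else snd p j)"
    for p :: "(real^'q) \<times> (nat \<Rightarrow> real^'q)"
  have [measurable]: "h \<in> measurable (borel \<Otimes>\<^sub>M obs_space k) (obs_space (Suc k))"
    unfolding h_def[abs_def]
  proof (rule measurable_restrict)
    fix j assume j: "j \<in> {1..Suc k}"
    have [measurable]: "(\<lambda>y. amean y k) \<in> borel_measurable (obs_space k)"
      by (rule measurable_amean) simp
    show "(\<lambda>p. if j = Suc k then H *v (B *v amean (snd p) k) + fst p else snd p j) \<in> borel_measurable (borel \<Otimes>\<^sub>M obs_space k)"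
    proof (cases "j = Suc k")
      case False
      then have "(\<lambda>y. y j) \<in> borel_measurable (obs_space k)"
        using j by (intro measurable_component_singleton) auto
      then show ?thesis using False by simp
    next
      case True
      have "(\<lambda>p. H *v (B *v amean (snd p) k) + fst p) \<in> borel_measurable (borel \<Otimes>\<^sub>M obs_space k)"
        by measurable
      then show ?thesis using True by simp
    qed
  qed
  have "obs (Suc k) \<omega> = h (innov k \<omega>, obs k \<omega>)" if "\<omega> \<in> space M" for \<omega>
    using Y_Suc_eq[OF that] by (auto simp: h_def restrict_def fun_eq_iff)
  moreover have "indep_rv M borel (\<lambda>\<omega>. err (Suc k) \<omega>) (obs_space (Suc k)) (\<lambda>\<omega>. h (innov k \<omega>, obs k \<omega>))"
    by (rule indep_rv_compose[OF innov_obs]) measurable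
  ultimately show "indep_rv M borel (err (Suc k)) (obs_space (Suc k)) (obs (Suc k))"
    by (subst indep_rv_cong[OF refl]) auto
qed

lemma err_gaussian_indep:
  "cis_gaussian M (err k) (acov k) \<and> indep_rv M borel (err k) (obs_space k) (obs k)"
proof (induction k)
  case 0
  have "err 0 = (\<lambda>\<omega>. X 0 \<omega> - m0)" by (simp add: err_def fun_eq_iff)
  then have gauss: "cis_gaussian M (err 0) (acov 0)" using X0_gauss by simp
  \<comment> \<open>Before the first observation the tuple has an empty index set and is the
    constant \<open>undefined\<close> function, hence independent of everything.\<close>
  have "obs 0 = (\<lambda>_ _. undefined)" by (simp add: fun_eq_iff)
  then have "indep_rv M borel (err 0) (obs_space 0) (obs 0)"
    using indep_rv_const[OF cis_gaussian_measurable[OF gauss], of "\<lambda>_. undefined" "obs_space 0"]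
    by (simp add: space_PiM)
  with gauss show ?case by blast
qed (use err_step in blast)

end

theorem mainTheorem4:
  fixes M :: "'a measure" and N :: "'b measure"
    and B :: "real^'d^'d" and C :: "real^'w^'d"
    and H :: "real^'d^'q" and \<Gamma> :: "real^'v^'q"
    and T :: "real^'d^'d \<Rightarrow> real^'d^'d"
    and X :: "nat \<Rightarrow> 'a \<Rightarrow> real^'d" and Y :: "nat \<Rightarrow> 'a \<Rightarrow> real^'q"
    and W :: "nat \<Rightarrow> 'a \<Rightarrow> real^'w" and V :: "nat \<Rightarrow> 'a \<Rightarrow> real^'v"
    and Xa0 :: "'b \<Rightarrow> real^'d" and Wmf :: "nat \<Rightarrow> 'b \<Rightarrow> real^'w"
    and Xf Xa :: "(nat \<Rightarrow> real^'q) \<Rightarrow> nat \<Rightarrow> 'b \<Rightarrow> real^'d"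
  assumes Q_pos: "pos_def (C ** transpose C)"
    and R_pos: "pos_def (\<Gamma> ** transpose \<Gamma>)"
    and T_consistent: "\<And>P. pos_semidef P \<Longrightarrow>
      T P ** P ** transpose (T P) =
      (mat 1 - kalman_gain H (\<Gamma> ** transpose \<Gamma>) P ** H) ** P"
      \<comment> \<open>the linear filtering model\<close>
    and M_prob: "prob_space M"
    and X_0_meas: "X 0 \<in> borel_measurable M"
    and W_gauss: "\<And>k. k \<ge> 1 \<Longrightarrow> distributed M lborel (W k) std_gaussian_density"
    and V_gauss: "\<And>k. k \<ge> 1 \<Longrightarrow> distributed M lborel (V k) std_gaussian_density"
    and M_indep: "indep_init_noises M (X 0) W V"
    and X_step: "\<And>k \<omega>. k \<ge> 1 \<Longrightarrow> \<omega> \<in> space M \<Longrightarrow>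
      X k \<omega> = B *v X (k - 1) \<omega> + C *v W k \<omega>"
    and Y_obs: "\<And>k \<omega>. k \<ge> 1 \<Longrightarrow> \<omega> \<in> space M \<Longrightarrow>
      Y k \<omega> = H *v X k \<omega> + \<Gamma> *v V k \<omega>"
      \<comment> \<open>the mean-field process, for each fixed observation sequence y\<close>
    and N_prob: "prob_space N"
    and Xa0_moment: "finite_second_moment N Xa0"
    and Wmf_gauss: "\<And>k. k \<ge> 1 \<Longrightarrow> distributed N lborel (Wmf k) std_gaussian_density"
    and N_indep: "indep_init_noise N Xa0 Wmf"
    and Xa_init: "\<And>y \<omega>. \<omega> \<in> space N \<Longrightarrow> Xa y 0 \<omega> = Xa0 \<omega>"
    and Xf_step: "\<And>y k \<omega>. k \<ge> 1 \<Longrightarrow> \<omega> \<in> space N \<Longrightarrow>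
      Xf y k \<omega> = B *v Xa y (k - 1) \<omega> + C *v Wmf k \<omega>"
    and Xa_step: "\<And>y k \<omega>. k \<ge> 1 \<Longrightarrow> \<omega> \<in> space N \<Longrightarrow>
      Xa y k \<omega> =
        (mean_vec N (Xf y k)
          + kalman_gain H (\<Gamma> ** transpose \<Gamma>) (cov_mat N (Xf y k))
              *v (y k - H *v mean_vec N (Xf y k)))
        + T (cov_mat N (Xf y k)) *v (Xf y k \<omega> - mean_vec N (Xf y k))"
  shows
    "(\<forall>y. \<forall>k\<ge>1.
        finite_second_moment N (Xf y k) \<and> finite_second_moment N (Xa y k) \<and>
        mean_vec N (Xf y k) = B *v mean_vec N (Xa y (k - 1)) \<and>
        mean_vec N (Xa y k) =
          mean_vec N (Xf y k)
            + kalman_gain H (\<Gamma> ** transpose \<Gamma>) (cov_mat N (Xf y k))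
                *v (y k - H *v mean_vec N (Xf y k)) \<and>
        cov_mat N (Xf y k) =
          B ** cov_mat N (Xa y (k - 1)) ** transpose B + C ** transpose C \<and>
        cov_mat N (Xa y k) =
          (mat 1 - kalman_gain H (\<Gamma> ** transpose \<Gamma>) (cov_mat N (Xf y k)) ** H)
            ** cov_mat N (Xf y k)) \<and>
     (\<forall>\<pi>\<^sub>0. gaussian \<pi>\<^sub>0 \<and> distr M borel (X 0) = \<pi>\<^sub>0 \<and> distr N borel Xa0 = \<pi>\<^sub>0 \<longrightarrow>
        (\<forall>k\<ge>1.
          regular_cond_distr M borel (X k)
            (Pi\<^sub>M {1..k} (\<lambda>_. borel)) (\<lambda>\<omega>. \<lambda>j\<in>{1..k}. Y j \<omega>)
            (\<lambda>y. distr N borel (Xa y k))))"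
proof -
  interpret mf: mean_field N B C H "\<Gamma> ** transpose \<Gamma>" Xa0 T Wmf Xf Xa
    by (intro mean_field.intro mean_field_axioms.intro) (fact assms)+
  have moments: "finite_second_moment N (Xf y k) \<and> finite_second_moment N (Xa y k) \<and>
        mean_vec N (Xf y k) = B *v mean_vec N (Xa y (k - 1)) \<and>
        mean_vec N (Xa y k) =
          mean_vec N (Xf y k)
            + kalman_gain H (\<Gamma> ** transpose \<Gamma>) (cov_mat N (Xf y k))
                *v (y k - H *v mean_vec N (Xf y k)) \<and>
        cov_mat N (Xf y k) =
          B ** cov_mat N (Xa y (k - 1)) ** transpose B + C ** transpose C \<and>
        cov_mat N (Xa y k) =
          (mat 1 - kalman_gain H (\<Gamma> ** transpose \<Gamma>) (cov_mat N (Xf y k)) ** H)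
            ** cov_mat N (Xf y k)" if "k \<ge> 1" for y k
  proof -
    obtain l where "k = Suc l" using \<open>k \<ge> 1\<close> by (cases k) auto
    then show ?thesis
      by (simp add: mf.Xf_moments mf.Xa_moments mf.fcov_def)
  qed
  have posterior: "regular_cond_distr M borel (X k)
            (Pi\<^sub>M {1..k} (\<lambda>_. borel)) (\<lambda>\<omega>. \<lambda>j\<in>{1..k}. Y j \<omega>)
            (\<lambda>y. distr N borel (Xa y k))"
    if "gaussian \<pi>\<^sub>0" and X0: "distr M borel (X 0) = \<pi>\<^sub>0" and Xa0: "distr N borel Xa0 = \<pi>\<^sub>0" for \<pi>\<^sub>0 k
  proof -
    have Xa0_meas: "Xa0 \<in> borel_measurable N" using Xa0_moment by (simp add: finite_second_moment_def)
    \<comment> \<open>The filter's recursion must start from the moments of \<open>Xa0\<close>, so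
      the parameters of the common initial law are expressed by them.\<close>
    have \<pi>: "mean_vec \<pi>\<^sub>0 (\<lambda>x. x) = mean_vec N Xa0" "cov_mat \<pi>\<^sub>0 (\<lambda>x. x) = cov_mat N Xa0"
      unfolding Xa0[symmetric] by (rule mean_vec_distr[OF Xa0_meas] cov_mat_distr[OF Xa0_meas])+
    have gauss: "cis_gaussian \<pi>\<^sub>0 (\<lambda>x. x - mean_vec N Xa0) (cov_mat N Xa0)"
      using gaussian_imp_cis_gaussian[OF \<open>gaussian \<pi>\<^sub>0\<close>] by (simp add: \<pi>)
    have gauss_X0: "cis_gaussian M (\<lambda>\<omega>. X 0 \<omega> - mean_vec N Xa0) (cov_mat N Xa0)"
      using gauss X_0_meas unfolding X0[symmetric] by (simp add: cis_gaussian_def integral_distr)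
    have "cis_gaussian N (\<lambda>\<omega>. Xa0 \<omega> - mean_vec N Xa0) (cov_mat N Xa0)"
      using gauss Xa0_meas unfolding Xa0[symmetric] by (simp add: cis_gaussian_def integral_distr)
    then have "cis_gaussian N (mf.dev 0) (mf.acov 0)"
      by (simp add: mf.dev.simps(1)[abs_def])
    then have dev: "cis_gaussian N (mf.dev k) (mf.acov k)" by (rule mf.cis_gaussian_dev)
    interpret lm: linear_model M B C H \<Gamma> "mean_vec N Xa0" "cov_mat N Xa0" X Y W V
      by (intro linear_model.intro linear_model_axioms.intro)
         (fact assms gauss_X0 mf.pos_semidef_fcov)+
    have err: "cis_gaussian M (lm.err k) (mf.acov k)"
      "indep_rv M borel (lm.err k) (Pi\<^sub>M {1..k} (\<lambda>_. borel)) (\<lambda>\<omega>. \<lambda>j\<in>{1..k}. Y j \<omega>)"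
      using lm.err_gaussian_indep[of k] by auto
    show ?thesis
    proof (rule regular_cond_distr_shift[OF M_prob N_prob err(2)])
      show "(\<lambda>y. mf.amean y k) \<in> borel_measurable (Pi\<^sub>M {1..k} (\<lambda>_. borel))"
        by (rule mf.measurable_amean) simp
      show "X k \<omega> = mf.amean (\<lambda>j\<in>{1..k}. Y j \<omega>) k + lm.err k \<omega>" for \<omega>
        by (simp add: lm.err_def)
      show "mf.dev k \<in> borel_measurable N" using dev by (rule cis_gaussian_measurable)
      \<comment> \<open>Both are centred Gaussian with the same parameter, because the two models
        run the same covariance recursion.\<close>
      show "distr N borel (mf.dev k) = distr M borel (lm.err k)"
        by (rule cis_gaussian_distr_eq[OF N_prob M_prob dev err(1)])
      show "distr N borel (Xa y k) = distr N borel (\<lambda>\<omega>. mf.amean y k + mf.dev k \<omega>)" for y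
        by (rule distr_cong) (auto simp: mf.Xa_eq)
    qed
  qed
  show ?thesis using moments posterior by blast
qed

end
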